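(* Let $a>0$ and $0<q<1$ be constants. Assume that $u_0\in C([0,a],\mathbb{R}_F^c)$ and that $f:(0,a]\times\mathbb{R}_F^c\to\mathbb{R}_F^c$ is continuous and compact (i.e. continuous and mapping bounded sets into relatively compact sets). Let $N=\sup_{t\in[0,a]}D(u_0(t),0)$, let $R>N$, let $G=\{(t,x)\in(0,a]\times\mathbb{R}_F^c: D(x,0)\le R\}$, let $M=\sup_{(t,x)\in G}D(f(t,x),0)$, and let $$\eta=\min\left\{a,\ \left[\frac{(R-N)\Gamma(q+1)}{M}\right]^{1/q}\right\}.$$ Then the fuzzy integral equation $$u(t)=u_0(t)+\frac{1}{\Gamma(q)}\int_0^t (t-s)^{q-1}f(s,u(s))\,ds$$ has at least one solution $u\in C([0,\eta],\mathbb{R}_F^c)$, i.e. there is $u\in C([0,\eta],\mathbb{R}_F^c)$ satisfying the equation for every $t\in[0,\eta]$.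
   Context: $K_c(\mathbb{R})$ is the family of all nonempty, compact, convex subsets of $\mathbb{R}$, with the Hausdorff-Pompeiu metric $d_H(A,B)=\max\{\sup_{x\in A}\inf_{y\in B}|x-y|,\ \sup_{y\in B}\inf_{x\in A}|x-y|\}$, and operations $A+B=\{a+b: a\in A, b\in B\}$, $\lambda A=\{\lambda a: a\in A\}$. $\mathbb{R}_F$ (the space of fuzzy numbers on $\mathbb{R}$) is the set of all functions $u:\mathbb{R}\to[0,1]$ such that: (1) $u$ is normal: there is $t_0\in\mathbb{R}$ with $u(t_0)=1$; (2) $u$ is fuzzy convex: $u(\lambda t_1+(1-\lambda)t_2)\ge\min\{u(t_1),u(t_2)\}$ for all $t_1,t_2\in\mathbb{R}$, $\lambda\in[0,1]$; (3) $u$ is upper semicontinuous; (4) the closure of $\{t: u(t)>0\}$ is compact. For $u\in\mathbb{R}_F$ the level sets are $[u]^\alpha=\{t\in\mathbb{R}: u(t)\ge\alpha\}$ for $\alpha\in(0,1]$ and $[u]^0=\overline{\{t\in\mathbb{R}: u(t)>0\}}$; each belongs to $K_c(\mathbb{R})$. Addition and scalar multiplication on $\mathbb{R}_F$ (by Zadeh's extension principle) satisfy, and are determined by, $[u+v]^\alpha=[u]^\alpha+[v]^\alpha$ and $[ku]^\alpha=k[u]^\alpha$ for all $\alpha\in[0,1]$, $k\in\mathbb{R}$. The fuzzy null set $0\in\mathbb{R}_F$ is the function equal to $1$ at $t=0$ and $0$ elsewhere. The metric is $D(u,v)=\sup_{\alpha\in[0,1]}d_H([u]^\alpha,[v]^\alpha)$.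 $\mathbb{R}_F^c$ is the set of $u\in\mathbb{R}_F$ such that $\alpha\mapsto[u]^\alpha$, $[0,1]\to K_c(\mathbb{R})$, is continuous; it carries the metric $D$. $C(I,\mathbb{R}_F^c)$ is the set of continuous maps $I\to(\mathbb{R}_F^c,D)$. Integral: for an interval $T$ and $F:T\to\mathbb{R}_F$, put $F_\alpha(t)=[F(t)]^\alpha$. $F$ is strongly measurable if each set-valued map $F_\alpha:T\to K_c(\mathbb{R})$, $\alpha\in[0,1]$, is Lebesgue measurable, and integrably bounded if there is an integrable $k:T\to\mathbb{R}_+$ with $d_H(F_0(t),\{0\})\le k(t)$ for all $t\in T$. The integral $\int_T F(t)\,dt$ is defined levelwise by $\left[\int_T F(t)\,dt\right]^\alpha=\int_T F_\alpha(t)\,dt=\left\{\int_T g(t)\,dt: g:T\to\mathbb{R}\text{ is a measurable selection of }F_\alpha\right\}$ for $\alpha\in[0,1]$; a strongly measurable and integrably bounded $F$ is integrable if this defines an element of $\mathbb{R}_F$. In the integral equation the integrand is considered on $0<s<t$ (the endpoints form a null set). $\Gamma$ is the Gamma function. $M$ is finite because $f$ is compact; if $M=0$, the bracketed quantity in the definition of $\eta$ is read as $+\infty$, so $\eta=a$. *)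

theory Defs
  imports "HOL-Analysis.Analysis"
begin

section \<open>The metric space \<open>K\<^sub>c(\<real>)\<close>\<close>

definition hausdorff_dist :: "real set \<Rightarrow> real set \<Rightarrow> real" where
  "hausdorff_dist A B =
     max (SUP x\<in>A. INF y\<in>B. \<bar>x - y\<bar>) (SUP y\<in>B. INF x\<in>A. \<bar>x - y\<bar>)"

typedef kc = "{A :: real set. A \<noteq> {} \<and> compact A \<and> convex A}"
  morphisms set_of_kc Kc
  by (rule exI[of _ "{0}"]) auto

lemma kc_interval:
  obtains l r where "l \<le> r" "set_of_kc A = {l..r}"
proof -
  have A: "set_of_kc A \<noteq> {}" "compact (set_of_kc A)" "convex (set_of_kc A)"
    using set_of_kc[of A] by auto
  then obtain l r where "set_of_kc A = {l..r}"
    using connected_compact_interval_1 convex_connected by blast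
  with A show thesis using that by (metis atLeastatMost_empty_iff)
qed

lemma INF_dist_interval:
  fixes x c d :: real
  assumes "c \<le> d"
  shows "(INF y\<in>{c..d}. \<bar>x - y\<bar>) = max 0 (max (c - x) (x - d))"
proof (rule cInf_eq_minimum)
  have "max c (min x d) \<in> {c..d}" "max 0 (max (c - x) (x - d)) = \<bar>x - max c (min x d)\<bar>"
    using assms by auto
  then show "max 0 (max (c - x) (x - d)) \<in> (\<lambda>y. \<bar>x - y\<bar>) ` {c..d}"
    by blast
qed auto

lemma SUP_INF_dist_interval:
  fixes a b c d :: real
  assumes "a \<le> b" "c \<le> d"
  shows "(SUP x\<in>{a..b}. INF y\<in>{c..d}. \<bar>x - y\<bar>) = max 0 (max (c - a) (b - d))"
proof (rule cSup_eq_maximum)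
  have "max 0 (max (c - a) (b - d)) = max 0 (max (c - a) (a - d)) \<or>
        max 0 (max (c - a) (b - d)) = max 0 (max (c - b) (b - d))"
    using assms by auto
  then show "max 0 (max (c - a) (b - d)) \<in> (\<lambda>x. INF y\<in>{c..d}. \<bar>x - y\<bar>) ` {a..b}"
    using assms by (auto simp: INF_dist_interval)
qed (use assms in \<open>auto simp: INF_dist_interval\<close>)

lemma hausdorff_dist_interval:
  assumes "a \<le> b" "c \<le> d"
  shows "hausdorff_dist {a..b} {c..d} = max \<bar>a - c\<bar> \<bar>b - d\<bar>"
proof -
  have "(SUP y\<in>{c..d}. INF x\<in>{a..b}. \<bar>x - y\<bar>) = max 0 (max (a - c) (d - b))"
    using SUP_INF_dist_interval[OF assms(2,1)] by (simp add: abs_minus_commute)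
  with SUP_INF_dist_interval[OF assms] show ?thesis
    unfolding hausdorff_dist_def by (simp add: max_def abs_if)
qed

instantiation kc :: metric_space
begin

definition dist_kc :: "kc \<Rightarrow> kc \<Rightarrow> real" where
  "dist_kc A B = hausdorff_dist (set_of_kc A) (set_of_kc B)"

definition uniformity_kc :: "(kc \<times> kc) filter" where
  "uniformity_kc = (INF e\<in>{0<..}. principal {(x, y). dist x y < e})"

definition open_kc :: "kc set \<Rightarrow> bool" where
  "open_kc U = (\<forall>x\<in>U. \<forall>\<^sub>F (x', y) in uniformity. x' = x \<longrightarrow> y \<in> U)"

instance
proof
  fix A B C :: kc
  obtain a b where A: "a \<le> b" "set_of_kc A = {a..b}" using kc_interval .
  obtain c d where B: "c \<le> d" "set_of_kc B = {c..d}" using kc_interval .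
  obtain e f where C: "e \<le> f" "set_of_kc C = {e..f}" using kc_interval .
  show "dist A B = 0 \<longleftrightarrow> A = B"
    using A B by (auto simp: dist_kc_def hausdorff_dist_interval simp flip: set_of_kc_inject)
  show "dist A B \<le> dist A C + dist B C"
    using A B C by (auto simp: dist_kc_def hausdorff_dist_interval)
qed (auto simp: uniformity_kc_def open_kc_def)

end


section \<open>Fuzzy numbers\<close>

definition upper_semicont :: "(real \<Rightarrow> real) \<Rightarrow> bool" where
  "upper_semicont u \<longleftrightarrow> (\<forall>t c. u t < c \<longrightarrow> (\<forall>\<^sub>F s in nhds t. u s < c))"

definition is_fuzzy_number :: "(real \<Rightarrow> real) \<Rightarrow> bool" where
  "is_fuzzy_number u \<longleftrightarrow>
     range u \<subseteq> {0..1} \<and>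
     (\<exists>t\<^sub>0. u t\<^sub>0 = 1) \<and>
     (\<forall>t\<^sub>1 t\<^sub>2. \<forall>l\<in>{0..1}. u (l * t\<^sub>1 + (1 - l) * t\<^sub>2) \<ge> min (u t\<^sub>1) (u t\<^sub>2)) \<and>
     upper_semicont u \<and>
     compact (closure {t. u t > 0})"

definition level_set :: "(real \<Rightarrow> real) \<Rightarrow> real \<Rightarrow> real set" where
  "level_set u \<alpha> = (if \<alpha> = 0 then closure {t. u t > 0} else {t. u t \<ge> \<alpha>})"

lemma upper_semicont_iff_closed:
  "upper_semicont u \<longleftrightarrow> (\<forall>c. closed {t. u t \<ge> c})"
proof -
  have "upper_semicont u \<longleftrightarrow> (\<forall>c. open {t. u t < c})"
    unfolding upper_semicont_def eventually_nhds open_subopen[of "Collect _"]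
    by (auto simp: subset_eq)
  moreover have "{t. u t < c} = - {t. u t \<ge> c}" for c by auto
  ultimately show ?thesis by (simp add: closed_def)
qed

lemma is_fuzzy_number_null: "is_fuzzy_number (\<lambda>t. if t = 0 then 1 else 0)"
proof -
  have "closed {t::real. (if t = 0 then 1 else 0) \<ge> (c::real)}" for c
  proof -
    have "{t::real. (if t = 0 then 1 else 0) \<ge> c} = (if c \<le> 0 then UNIV else if c \<le> 1 then {0} else {})"
      by auto
    then show ?thesis by simp
  qed
  moreover have "{t::real. (if t = 0 then 1 else 0) > (0::real)} = {0}" by auto
  ultimately show ?thesis
    unfolding is_fuzzy_number_def upper_semicont_iff_closed
    by (auto simp: image_subset_iff)
qed

typedef fuzzy = "{u. is_fuzzy_number u}"
  morphisms membership Fuzzy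
  using is_fuzzy_number_null by blast

lemma is_fuzzy_number_membership: "is_fuzzy_number (membership u)"
  using membership[of u] by simp

lemma fuzzy_number_bounds: "is_fuzzy_number u \<Longrightarrow> 0 \<le> u t \<and> u t \<le> 1"
  by (auto simp: is_fuzzy_number_def image_subset_iff)

lemma compact_closed_subset:
  fixes K C :: "'a::topological_space set"
  assumes "closed K" "K \<subseteq> C" "compact C"
  shows "compact K"
  using compact_Int_closed[OF assms(3,1)] assms(2) by (simp add: Int_absorb1)

lemma level_set_antimono:
  assumes "is_fuzzy_number u" "0 \<le> \<alpha>" "\<alpha> \<le> \<beta>"
  shows "level_set u \<beta> \<subseteq> level_set u \<alpha>"
  using assms closure_subset[of "{t. u t > 0}"] by (auto simp: level_set_def)

lemma level_set_kc:
  assumes u: "is_fuzzy_number u" and \<alpha>: "\<alpha> \<in> {0..1}"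
  shows "level_set u \<alpha> \<noteq> {}" "compact (level_set u \<alpha>)" "convex (level_set u \<alpha>)"
proof -
  obtain t where "u t = 1" using u by (auto simp: is_fuzzy_number_def)
  with \<alpha> have "t \<in> level_set u 1" by (simp add: level_set_def)
  with level_set_antimono[OF u] \<alpha> show "level_set u \<alpha> \<noteq> {}" by auto
  show "compact (level_set u \<alpha>)"
  proof (cases "\<alpha> = 0")
    case False
    have "closed (level_set u \<alpha>)"
      using False u by (simp add: level_set_def is_fuzzy_number_def upper_semicont_iff_closed)
    moreover have "level_set u \<alpha> \<subseteq> level_set u 0"
      using level_set_antimono[OF u] \<alpha> by simp
    moreover have "compact (level_set u 0)"
      using u by (simp add: level_set_def is_fuzzy_number_def)
    ultimately show ?thesis by (meson compact_closed_subset)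
  qed (use u in \<open>simp add: level_set_def is_fuzzy_number_def\<close>)
  have qc: "u (l * s + (1 - l) * t) \<ge> min (u s) (u t)" if "0 \<le> l" "l \<le> 1" for s t l
    using u that by (simp add: is_fuzzy_number_def)
  have "convex {t. P (u t)}" if P: "\<And>x y z. P x \<Longrightarrow> P y \<Longrightarrow> min x y \<le> z \<Longrightarrow> P z" for P
  proof (rule convexI, simp)
    fix x y p q :: real
    assume *: "P (u x)" "P (u y)" "0 \<le> p" "0 \<le> q" "p + q = 1"
    then have q: "q = 1 - p" by simp
    from * show "P (u (p * x + q * y))"
      unfolding q by (intro P[OF *(1,2)] qc) simp_all
  qed
  from this[of "\<lambda>r. r > 0"] this[of "\<lambda>r. r \<ge> \<alpha>"] show "convex (level_set u \<alpha>)"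
    by (auto simp: level_set_def convex_closure)
qed

text \<open>The level \<open>[u]\<^sup>\<alpha>\<close> as a point of \<open>K\<^sub>c(\<real>)\<close>; it is meaningful only for \<open>\<alpha> \<in> {0..1}\<close>
  and is used only there.\<close>

definition level :: "fuzzy \<Rightarrow> real \<Rightarrow> kc" where
  "level u \<alpha> = Kc (level_set (membership u) \<alpha>)"

lemma set_of_kc_level:
  "\<alpha> \<in> {0..1} \<Longrightarrow> set_of_kc (level u \<alpha>) = level_set (membership u) \<alpha>"
  unfolding level_def using level_set_kc[OF is_fuzzy_number_membership]
  by (intro Kc_inverse) auto

lemma fuzzy_eqI:
  assumes "\<And>\<alpha>. \<alpha> \<in> {0..1} \<Longrightarrow> level u \<alpha> = level v \<alpha>"
  shows "u = v"
proof -
  have le: "membership w t \<le> membership w' t"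
    if eq: "\<And>\<alpha>. \<alpha> \<in> {0..1} \<Longrightarrow> level w \<alpha> = level w' \<alpha>" for w w' t
  proof -
    let ?a = "membership w t"
    have a: "?a \<in> {0..1}" "membership w' t \<in> {0..1}"
      using is_fuzzy_number_membership[of w] is_fuzzy_number_membership[of w']
      using fuzzy_number_bounds by auto
    show ?thesis
    proof (cases "?a = 0")
      case False
      have "level_set (membership w) ?a = level_set (membership w') ?a"
        using set_of_kc_level[OF a(1), of w] set_of_kc_level[OF a(1), of w'] eq[OF a(1)] by simp
      moreover have "t \<in> level_set (membership w) ?a" using False by (simp add: level_set_def)
      ultimately show ?thesis using False by (simp add: level_set_def)
    qed (use a in simp)
  qed
  have "membership u = membership v"
    using le[of u v] le[of v u] assms by (intro ext antisym) auto
  then show ?thesis by (simp add: membership_inject)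
qed

lemma bdd_above_dist_level: "bdd_above ((\<lambda>\<alpha>. dist (level u \<alpha>) (level v \<alpha>)) ` {0..1})"
proof -
  obtain a b where u: "a \<le> b" "set_of_kc (level u 0) = {a..b}" using kc_interval .
  obtain c d where v: "c \<le> d" "set_of_kc (level v 0) = {c..d}" using kc_interval .
  have sub: "set_of_kc (level w \<alpha>) \<subseteq> set_of_kc (level w 0)" if "\<alpha> \<in> {0..1}" for w \<alpha>
    using that level_set_antimono[OF is_fuzzy_number_membership, of 0 \<alpha> w]
    by (simp add: set_of_kc_level)
  have "dist (level u \<alpha>) (level v \<alpha>) \<le> \<bar>a\<bar> + \<bar>b\<bar> + \<bar>c\<bar> + \<bar>d\<bar>" if \<alpha>: "\<alpha> \<in> {0..1}" for \<alpha>
  proof -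
    obtain a' b' where u': "a' \<le> b'" "set_of_kc (level u \<alpha>) = {a'..b'}" using kc_interval .
    obtain c' d' where v': "c' \<le> d'" "set_of_kc (level v \<alpha>) = {c'..d'}" using kc_interval .
    have "a \<le> a'" "b' \<le> b" "c \<le> c'" "d' \<le> d"
      using sub[OF \<alpha>, of u] sub[OF \<alpha>, of v] u v u' v' by auto
    then show ?thesis using u' v' by (auto simp: dist_kc_def hausdorff_dist_interval)
  qed
  then show ?thesis by (meson bdd_aboveI2)
qed

instantiation fuzzy :: metric_space
begin

definition dist_fuzzy :: "fuzzy \<Rightarrow> fuzzy \<Rightarrow> real" where
  "dist_fuzzy u v = (SUP \<alpha>\<in>{0..1}. dist (level u \<alpha>) (level v \<alpha>))"

definition uniformity_fuzzy :: "(fuzzy \<times> fuzzy) filter" where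
  "uniformity_fuzzy = (INF e\<in>{0<..}. principal {(x, y). dist x y < e})"

definition open_fuzzy :: "fuzzy set \<Rightarrow> bool" where
  "open_fuzzy U = (\<forall>x\<in>U. \<forall>\<^sub>F (x', y) in uniformity. x' = x \<longrightarrow> y \<in> U)"

instance
proof
  fix u v w :: fuzzy
  have le: "dist (level x \<alpha>) (level y \<alpha>) \<le> dist x y" if "\<alpha> \<in> {0..1}" for x y \<alpha>
    unfolding dist_fuzzy_def using that by (intro cSUP_upper bdd_above_dist_level)
  show "dist u v = 0 \<longleftrightarrow> u = v"
  proof
    assume "dist u v = 0"
    then have "dist (level u \<alpha>) (level v \<alpha>) = 0" if "\<alpha> \<in> {0..1}" for \<alpha>
      using le[OF that, of u v] by (simp add: order_antisym)
    then show "u = v" by (intro fuzzy_eqI) simp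
  qed (simp add: dist_fuzzy_def)
  have "dist (level u \<alpha>) (level v \<alpha>) \<le> dist u w + dist v w" if "\<alpha> \<in> {0..1}" for \<alpha>
    using dist_triangle2[of "level u \<alpha>" "level v \<alpha>" "level w \<alpha>"] le[OF that, of u w] le[OF that, of v w]
    by linarith
  then show "dist u v \<le> dist u w + dist v w"
    unfolding dist_fuzzy_def[of u v] by (intro cSUP_least) auto
qed (auto simp: uniformity_fuzzy_def open_fuzzy_def)

end


section \<open>Arithmetic by Zadeh's extension principle\<close>

definition zadeh_plus :: "(real \<Rightarrow> real) \<Rightarrow> (real \<Rightarrow> real) \<Rightarrow> real \<Rightarrow> real" where
  "zadeh_plus u v z = (SUP (x, y)\<in>{(x, y). x + y = z}. min (u x) (v y))"

text \<open>For \<open>k = 0\<close> the set of preimages of \<open>z \<noteq> 0\<close> is empty; its supremum in \<open>{0..1}\<close> is \<open>0\<close>,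
  which the inserted \<open>0\<close> accounts for.\<close>

definition zadeh_scale :: "real \<Rightarrow> (real \<Rightarrow> real) \<Rightarrow> real \<Rightarrow> real" where
  "zadeh_scale k u z = Sup (insert 0 (u ` {x. k * x = z}))"

instantiation fuzzy :: "{zero, plus, scaleR}"
begin

definition zero_fuzzy :: fuzzy where
  "zero_fuzzy = Fuzzy (\<lambda>t. if t = 0 then 1 else 0)"

definition plus_fuzzy :: "fuzzy \<Rightarrow> fuzzy \<Rightarrow> fuzzy" where
  "plus_fuzzy u v = Fuzzy (zadeh_plus (membership u) (membership v))"

definition scaleR_fuzzy :: "real \<Rightarrow> fuzzy \<Rightarrow> fuzzy" where
  "scaleR_fuzzy k u = Fuzzy (zadeh_scale k (membership u))"

instance ..

end

lemma membership_zero: "membership 0 = (\<lambda>t. if t = 0 then 1 else 0)"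
  unfolding zero_fuzzy_def using is_fuzzy_number_null by (simp add: Fuzzy_inverse)

lemma zadeh_plus_upper:
  assumes "is_fuzzy_number u"
  shows "min (u x) (v y) \<le> zadeh_plus u v (x + y)"
proof -
  have "u x \<le> 1" for x using assms fuzzy_number_bounds by blast
  then have "bdd_above ((\<lambda>(x, y). min (u x) (v y)) ` {(x', y'). x' + y' = x + y})"
    by (intro bdd_aboveI2[of _ _ 1]) (auto simp: min.coboundedI1)
  from cSUP_upper[OF _ this, of "(x, y)"] show ?thesis by (simp add: zadeh_plus_def)
qed

lemma zadeh_plus_attained:
  assumes u: "is_fuzzy_number u" and v: "is_fuzzy_number v"
  obtains x y where "x + y = z" "zadeh_plus u v z = min (u x) (v y)"
proof -
  let ?m = "zadeh_plus u v z"
  have nonneg: "u x \<ge> 0" "v x \<ge> 0" for x using u v fuzzy_number_bounds by blast+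
  have up: "min (u x) (v (z - x)) \<le> ?m" for x using zadeh_plus_upper[OF u, of x v "z - x"] by simp
  have "\<exists>x. ?m \<le> min (u x) (v (z - x))"
  proof (cases "?m \<le> 0")
    case True
    then show ?thesis using nonneg[of 0] nonneg[of z] by (intro exI[of _ 0]) simp
  next
    case False
    define K where "K n = {x. u x \<ge> ?m * (1 - 1 / Suc (Suc n)) \<and> v (z - x) \<ge> ?m * (1 - 1 / Suc (Suc n))}"
      for n :: nat
    have cl: "closed {x. v x \<ge> c}" "closed {x. u x \<ge> c}" for c
      using u v by (auto simp: is_fuzzy_number_def upper_semicont_iff_closed)
    have "closed ((\<lambda>x. z - x) -` {x. v x \<ge> c})" for c
      by (intro closed_vimage cl continuous_intros)
    then have "closed {x. v (z - x) \<ge> c}" for c by (simp add: vimage_def)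
    with cl(2) have "closed (K n)" for n
      unfolding K_def by (intro closed_Collect_conj)
    moreover have "compact (closure {t. u t > 0})" using u by (simp add: is_fuzzy_number_def)
    moreover have pos: "?m * (1 - 1 / Suc (Suc n)) > 0" for n
      using False by (intro mult_pos_pos) (auto simp: field_simps)
    then have "K n \<subseteq> closure {t. u t > 0}" for n
      using closure_subset[of "{t. u t > 0}"] unfolding K_def
      by (smt (verit, best) mem_Collect_eq subset_eq)
    ultimately have comp: "compact (K n)" for n by (meson compact_closed_subset)
    have ne: "K n \<noteq> {}" for n
    proof -
      have "?m * (1 - 1 / Suc (Suc n)) < ?m" using False by (simp add: field_simps)
      then have "\<exists>p\<in>{(x, y). x + y = z}. ?m * (1 - 1 / Suc (Suc n)) < (case p of (x, y) \<Rightarrow> min (u x) (v y))"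
        unfolding zadeh_plus_def
      proof (subst (asm) less_cSUP_iff)
        have "(0, z) \<in> {(x, y). x + y = z}" by simp
        then show "{(x, y). x + y = z} \<noteq> {}" by blast
        show "bdd_above ((\<lambda>(x, y). min (u x) (v y)) ` {(x, y). x + y = z})"
          using fuzzy_number_bounds[OF u] by (intro bdd_aboveI2[of _ _ 1]) (auto simp: min.coboundedI1)
      qed
      then obtain x y where xy: "x + y = z" "?m * (1 - 1 / Suc (Suc n)) < min (u x) (v y)" by auto
      then have "y = z - x" by simp
      with xy have "x \<in> K n" by (simp add: K_def)
      then show ?thesis by blast
    qed
    have anti: "K n \<subseteq> K m" if "m \<le> n" for m n
    proof -
      have "?m * (1 - 1 / Suc (Suc m)) \<le> ?m * (1 - 1 / Suc (Suc n))"
        using that False by (intro mult_left_mono diff_left_mono divide_left_mono) auto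
      then show ?thesis unfolding K_def by auto
    qed
    have "(\<Inter>n. K n) \<noteq> {}" using compact_nest[of K] comp ne anti by blast
    then obtain x where x: "\<And>n. x \<in> K n" by auto
    have "(\<lambda>n. ?m * (1 - 1 / Suc (Suc n))) \<longlonglongrightarrow> ?m * (1 - 0)"
      using filterlim_compose[OF lim_1_over_n[where 'a=real] filterlim_subseq[of "\<lambda>n. Suc (Suc n)"]]
      by (intro tendsto_intros) (simp_all add: strict_mono_def)
    then have "?m * (1 - 0) \<le> min (u x) (v (z - x))"
      by (rule LIMSEQ_le_const2) (use x in \<open>auto simp: K_def\<close>)
    then show ?thesis by auto
  qed
  then obtain x where "?m \<le> min (u x) (v (z - x))" by blast
  with up[of x] have "?m = min (u x) (v (z - x))" by simp
  then show thesis by (intro that[of x "z - x"]) auto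
qed

lemma zadeh_plus_superlevel:
  assumes u: "is_fuzzy_number u" and v: "is_fuzzy_number v"
    and P: "\<And>r s. P r \<Longrightarrow> r \<le> s \<Longrightarrow> P s"
  shows "{z. P (zadeh_plus u v z)} = {x + y |x y. x \<in> {x. P (u x)} \<and> y \<in> {y. P (v y)}}"
proof (intro set_eqI iffI)
  fix z assume "z \<in> {z. P (zadeh_plus u v z)}"
  moreover obtain x y where "x + y = z" "zadeh_plus u v z = min (u x) (v y)"
    using zadeh_plus_attained[OF u v] .
  ultimately show "z \<in> {x + y |x y. x \<in> {x. P (u x)} \<and> y \<in> {y. P (v y)}}"
    using P[of "min (u x) (v y)" "u x"] P[of "min (u x) (v y)" "v y"] by auto
next
  fix z assume "z \<in> {x + y |x y. x \<in> {x. P (u x)} \<and> y \<in> {y. P (v y)}}"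
  then obtain x y where "z = x + y" "P (u x)" "P (v y)" by auto
  then show "z \<in> {z. P (zadeh_plus u v z)}"
    using P[OF _ zadeh_plus_upper[OF u, of x v y]] by (auto simp: min_def)
qed

lemma level_set_zadeh_plus:
  assumes u: "is_fuzzy_number u" and v: "is_fuzzy_number v" and \<alpha>: "\<alpha> \<in> {0..1}"
  shows "level_set (zadeh_plus u v) \<alpha> = {x + y |x y. x \<in> level_set u \<alpha> \<and> y \<in> level_set v \<alpha>}"
proof (cases "\<alpha> = 0")
  case False
  then show ?thesis using zadeh_plus_superlevel[OF u v, of "\<lambda>r. \<alpha> \<le> r"] by (simp add: level_set_def)
next
  case True
  let ?U = "{t. u t > 0}" and ?V = "{t. v t > 0}"
  let ?S = "{x + y |x y. x \<in> ?U \<and> y \<in> ?V}" and ?T = "{x + y |x y. x \<in> closure ?U \<and> y \<in> closure ?V}"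
  have "compact ?T" using u v by (intro compact_sums) (auto simp: is_fuzzy_number_def)
  moreover have "?S \<subseteq> ?T" using closure_subset[of ?U] closure_subset[of ?V] by blast
  ultimately have "closure ?S \<subseteq> ?T" by (meson closure_minimal compact_imp_closed)
  moreover have "?T \<subseteq> closure ?S"
  proof clarify
    fix x y assume "x \<in> closure ?U" "y \<in> closure ?V"
    then obtain f g where fg: "\<And>n. f n \<in> ?U" "f \<longlonglongrightarrow> x" "\<And>n. g n \<in> ?V" "g \<longlonglongrightarrow> y"
      unfolding closure_sequential by blast
    then have "(\<lambda>n. f n + g n) \<longlonglongrightarrow> x + y" by (intro tendsto_add)
    moreover have "\<forall>n. f n + g n \<in> ?S" using fg by blast
    ultimately show "x + y \<in> closure ?S"
      unfolding closure_sequential by (intro exI[of _ "\<lambda>n. f n + g n"] conjI)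
  qed
  ultimately show ?thesis
    using True zadeh_plus_superlevel[OF u v, of "\<lambda>r. 0 < r"] by (simp add: level_set_def)
qed

lemma is_fuzzy_number_zadeh_plus:
  assumes u: "is_fuzzy_number u" and v: "is_fuzzy_number v"
  shows "is_fuzzy_number (zadeh_plus u v)"
proof -
  let ?w = "zadeh_plus u v"
  have u01: "0 \<le> u x" "u x \<le> 1" and v01: "0 \<le> v x" "v x \<le> 1" for x
    using u v fuzzy_number_bounds by blast+
  have w01: "0 \<le> ?w z \<and> ?w z \<le> 1" for z
  proof -
    obtain x y where "?w z = min (u x) (v y)" using zadeh_plus_attained[OF u v] by metis
    then show ?thesis using u01[of x] v01[of y] by auto
  qed
  obtain s t where "u s = 1" "v t = 1" using u v by (auto simp: is_fuzzy_number_def)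
  then have "?w (s + t) = 1"
    using zadeh_plus_upper[OF u, of s v t] w01[of "s + t"] by auto
  moreover have "min (?w z\<^sub>1) (?w z\<^sub>2) \<le> ?w (l * z\<^sub>1 + (1 - l) * z\<^sub>2)" if l: "l \<in> {0..1}" for z\<^sub>1 z\<^sub>2 l
  proof -
    obtain x\<^sub>1 y\<^sub>1 where 1: "x\<^sub>1 + y\<^sub>1 = z\<^sub>1" "?w z\<^sub>1 = min (u x\<^sub>1) (v y\<^sub>1)" using zadeh_plus_attained[OF u v] .
    obtain x\<^sub>2 y\<^sub>2 where 2: "x\<^sub>2 + y\<^sub>2 = z\<^sub>2" "?w z\<^sub>2 = min (u x\<^sub>2) (v y\<^sub>2)" using zadeh_plus_attained[OF u v] .
    have "min (u x\<^sub>1) (u x\<^sub>2) \<le> u (l * x\<^sub>1 + (1 - l) * x\<^sub>2)" "min (v y\<^sub>1) (v y\<^sub>2) \<le> v (l * y\<^sub>1 + (1 - l) * y\<^sub>2)"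
      using u v l unfolding is_fuzzy_number_def by blast+
    moreover have "l * z\<^sub>1 + (1 - l) * z\<^sub>2 = (l * x\<^sub>1 + (1 - l) * x\<^sub>2) + (l * y\<^sub>1 + (1 - l) * y\<^sub>2)"
      using 1 2 by (auto simp: algebra_simps)
    ultimately show ?thesis
      using 1 2 zadeh_plus_upper[OF u, of "l * x\<^sub>1 + (1 - l) * x\<^sub>2" v "l * y\<^sub>1 + (1 - l) * y\<^sub>2"] by auto
  qed
  moreover have "closed {z. ?w z \<ge> c}" for c
  proof (cases "c \<in> {0<..1}")
    case True
    have "compact {x + y |x y. x \<in> level_set u c \<and> y \<in> level_set v c}"
      using True by (intro compact_sums level_set_kc(2) u v) auto
    then have "compact (level_set ?w c)" using True by (simp add: level_set_zadeh_plus u v)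
    then show ?thesis using True by (simp add: level_set_def compact_imp_closed)
  next
    case False
    have "c \<le> ?w z" if "c \<le> 0" for z using that w01[of z] by linarith
    moreover have "\<not> c \<le> ?w z" if "c > 1" for z using that w01[of z] by linarith
    ultimately have "{z. ?w z \<ge> c} = (if c \<le> 0 then UNIV else {})" using False by auto
    then show ?thesis by simp
  qed
  moreover have "compact (closure {z. ?w z > 0})"
  proof -
    have "compact {x + y |x y. x \<in> level_set u 0 \<and> y \<in> level_set v 0}"
      by (intro compact_sums level_set_kc(2) u v) auto
    then have "compact (level_set ?w 0)" by (simp add: level_set_zadeh_plus u v)
    then show ?thesis by (simp add: level_set_def)
  qed
  ultimately show ?thesis
    using w01 unfolding is_fuzzy_number_def upper_semicont_iff_closed by (auto simp: image_subset_iff)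
qed

theorem level_plus:
  assumes "\<alpha> \<in> {0..1}"
  shows "set_of_kc (level (u + v) \<alpha>) =
    {x + y |x y. x \<in> set_of_kc (level u \<alpha>) \<and> y \<in> set_of_kc (level v \<alpha>)}"
proof -
  have "membership (u + v) = zadeh_plus (membership u) (membership v)"
    unfolding plus_fuzzy_def by (simp add: Fuzzy_inverse is_fuzzy_number_zadeh_plus is_fuzzy_number_membership)
  then show ?thesis
    using assms by (simp add: set_of_kc_level level_set_zadeh_plus is_fuzzy_number_membership)
qed

lemma zadeh_scale_eq:
  assumes u: "is_fuzzy_number u"
  shows "zadeh_scale k u = (if k = 0 then (\<lambda>t. if t = 0 then 1 else 0) else (\<lambda>z. u (z / k)))"
proof (rule ext)
  fix z
  have u01: "0 \<le> u x" "u x \<le> 1" for x using u fuzzy_number_bounds by blast+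
  show "zadeh_scale k u z = (if k = 0 then (\<lambda>t. if t = 0 then 1 else 0) else (\<lambda>z. u (z / k))) z"
  proof (cases "k = 0")
    case True
    obtain t where "u t = 1" using u by (auto simp: is_fuzzy_number_def)
    then have "Sup (insert 0 (range u)) = 1"
      by (intro cSup_eq_maximum) (use u01 in \<open>auto intro: rev_image_eqI\<close>)
    then show ?thesis using True by (auto simp: zadeh_scale_def)
  next
    case False
    then have "{x. k * x = z} = {z / k}" by (auto simp: field_simps)
    moreover have "Sup {0, u (z / k)} = u (z / k)"
      by (intro cSup_eq_maximum) (use u01 in auto)
    ultimately show ?thesis using False by (simp add: zadeh_scale_def)
  qed
qed

lemma is_fuzzy_number_zadeh_scale:
  assumes u: "is_fuzzy_number u"
  shows "is_fuzzy_number (zadeh_scale k u)"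
proof (cases "k = 0")
  case True
  then show ?thesis by (simp add: zadeh_scale_eq[OF u] is_fuzzy_number_null)
next
  case False
  obtain t where "u t = 1" using u by (auto simp: is_fuzzy_number_def)
  then have "\<exists>t. u (t / k) = 1" using False by (intro exI[of _ "k * t"]) simp
  moreover have "min (u (s / k)) (u (t / k)) \<le> u ((l * s + (1 - l) * t) / k)" if "l \<in> {0..1}" for s t l
  proof -
    have "min (u (s / k)) (u (t / k)) \<le> u (l * (s / k) + (1 - l) * (t / k))"
      using u that unfolding is_fuzzy_number_def by blast
    then show ?thesis by (simp add: add_divide_distrib)
  qed
  moreover have "closed {t. u (t / k) \<ge> c}" for c
  proof -
    have "closed ((\<lambda>t. t / k) -` {t. u t \<ge> c})"
      using u False
      by (intro closed_vimage continuous_intros) (auto simp: is_fuzzy_number_def upper_semicont_iff_closed)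
    then show ?thesis by (simp add: vimage_def)
  qed
  moreover have "compact (closure {t. u (t / k) > 0})"
  proof -
    have "{t. u (t / k) > 0} \<subseteq> (\<lambda>t. k * t) ` closure {t. u t > 0}"
      using False closure_subset[of "{t. u t > 0}"] by (auto intro!: image_eqI[of _ _ "_ / k"])
    moreover have "compact ((\<lambda>t. k * t) ` closure {t. u t > 0})"
      using u by (intro compact_continuous_image continuous_intros) (simp add: is_fuzzy_number_def)
    ultimately show ?thesis
      by (meson bounded_subset compact_closure compact_imp_bounded)
  qed
  ultimately show ?thesis
    using False u unfolding zadeh_scale_eq[OF u] is_fuzzy_number_def upper_semicont_iff_closed
    by (auto simp: image_subset_iff)
qed

theorem level_scaleR:
  assumes \<alpha>: "\<alpha> \<in> {0..1}"
  shows "set_of_kc (level (k *\<^sub>R u) \<alpha>) = (\<lambda>x. k * x) ` set_of_kc (level u \<alpha>)"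
proof -
  let ?u = "membership u"
  note fu = is_fuzzy_number_membership[of u]
  have m: "membership (k *\<^sub>R u) = zadeh_scale k ?u"
    unfolding scaleR_fuzzy_def by (simp add: Fuzzy_inverse is_fuzzy_number_zadeh_scale fu)
  have "level_set (zadeh_scale k ?u) \<alpha> = (\<lambda>x. k * x) ` level_set ?u \<alpha>"
  proof (cases "k = 0")
    case True
    have "{t::real. (if t = 0 then 1 else 0) > (0::real)} = {0}" by auto
    moreover have "{t::real. (if t = 0 then 1 else 0) \<ge> \<alpha>} = {0}" if "\<alpha> \<noteq> 0" using \<alpha> that by auto
    ultimately have "level_set (zadeh_scale k ?u) \<alpha> = {0}"
      using True by (simp add: zadeh_scale_eq[OF fu] level_set_def)
    with True level_set_kc(1)[OF fu \<alpha>] show ?thesis by (simp add: image_constant_conv)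
  next
    case False
    have im: "{t. P (?u (t / k))} = (\<lambda>x. k * x) ` {t. P (?u t)}" for P
      using False by (auto intro!: image_eqI[of _ _ "_ / k"])
    have "closure ((\<lambda>x. k *\<^sub>R x) ` {t. 0 < ?u t}) = (\<lambda>x. k *\<^sub>R x) ` closure {t. 0 < ?u t}"
      by (rule closure_scaleR[symmetric])
    then show ?thesis
      using False im[of "\<lambda>r. \<alpha> \<le> r"] im[of "\<lambda>r. 0 < r"] by (simp add: zadeh_scale_eq[OF fu] level_set_def)
  qed
  then show ?thesis using \<alpha> by (simp add: set_of_kc_level m)
qed


section \<open>Fuzzy numbers with continuous levels, relative compactness\<close>

definition RFc :: "fuzzy set" where
  "RFc = {u. continuous_on {0..1} (level u)}"

text \<open>\<open>S\<close> is relatively compact in the subspace \<open>X\<close>: its closure in \<open>X\<close> is compact.\<close>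

definition relatively_compact_in :: "'a::topological_space set \<Rightarrow> 'a set \<Rightarrow> bool" where
  "relatively_compact_in X S \<longleftrightarrow> compact (X \<inter> closure S)"

definition compact_map_on ::
  "'a::metric_space set \<Rightarrow> 'b::metric_space set \<Rightarrow> ('a \<Rightarrow> 'b) \<Rightarrow> bool" where
  "compact_map_on X Y f \<longleftrightarrow>
     (\<forall>B. B \<subseteq> X \<longrightarrow> bounded B \<longrightarrow> relatively_compact_in Y (f ` B))"


section \<open>Integration\<close>

text \<open>Lebesgue measurability of the levels refers to the topology of \<open>K\<^sub>c(\<real>)\<close> induced
  by the Hausdorff metric.\<close>

definition strongly_measurable :: "real set \<Rightarrow> (real \<Rightarrow> fuzzy) \<Rightarrow> bool" where
  "strongly_measurable T F \<longleftrightarrow>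
     (\<forall>\<alpha>\<in>{0..1}. (\<lambda>t. level (F t) \<alpha>) \<in> borel_measurable (lebesgue_on T))"

definition integrably_bounded :: "real set \<Rightarrow> (real \<Rightarrow> fuzzy) \<Rightarrow> bool" where
  "integrably_bounded T F \<longleftrightarrow>
     (\<exists>k. integrable (lebesgue_on T) k \<and>
          (\<forall>t\<in>T. 0 \<le> k t \<and> hausdorff_dist (set_of_kc (level (F t) 0)) {0} \<le> k t))"

definition aumann_integral :: "real set \<Rightarrow> (real \<Rightarrow> real set) \<Rightarrow> real set" where
  "aumann_integral T \<Phi> =
     {integral\<^sup>L (lebesgue_on T) g |g. g \<in> borel_measurable (lebesgue_on T) \<and> (\<forall>t\<in>T. g t \<in> \<Phi> t)}"

definition is_fuzzy_integral :: "real set \<Rightarrow> (real \<Rightarrow> fuzzy) \<Rightarrow> fuzzy \<Rightarrow> bool" where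
  "is_fuzzy_integral T F v \<longleftrightarrow>
     (\<forall>\<alpha>\<in>{0..1}. set_of_kc (level v \<alpha>) = aumann_integral T (\<lambda>t. set_of_kc (level (F t) \<alpha>)))"

definition fuzzy_integrable :: "real set \<Rightarrow> (real \<Rightarrow> fuzzy) \<Rightarrow> bool" where
  "fuzzy_integrable T F \<longleftrightarrow>
     strongly_measurable T F \<and> integrably_bounded T F \<and> (\<exists>v. is_fuzzy_integral T F v)"

definition fuzzy_integral :: "real set \<Rightarrow> (real \<Rightarrow> fuzzy) \<Rightarrow> fuzzy" where
  "fuzzy_integral T F = (THE v. is_fuzzy_integral T F v)"

lemma fuzzy_integral_eqI: "is_fuzzy_integral T F v \<Longrightarrow> fuzzy_integral T F = v"
  unfolding fuzzy_integral_def
  by (intro the_equality fuzzy_eqI) (auto simp: is_fuzzy_integral_def simp flip: set_of_kc_inject)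

end

theory Submission
  imports Defs "HOL-Complex_Analysis.Great_Picard"
begin

text \<open>A fuzzy number with continuous levels is a pair of continuous endpoint functions on \<open>{0..1}\<close>,
  and the fuzzy integral is the Lebesgue integral of the endpoints. For \<open>d > 0\<close> the delayed equation,
  with \<open>f (s, u (max 0 (s - d)))\<close> as integrand, is solvable explicitly on successive intervals of
  length \<open>d\<close>, and the choice of \<open>\<eta>\<close> keeps its solutions in the ball of radius \<open>R\<close>. Their endpoints,
  as functions of \<open>(t, \<alpha>)\<close> in a compact rectangle, are equicontinuous: in \<open>t\<close> because of the Hoelder
  continuity of the fractional integral, in \<open>\<alpha>\<close> because a compact set of fuzzy numbers has a common
  modulus of continuity, which integration preserves. Arzela-Ascoli in the plane thus
  replaces Schauder's theorem, and dominated convergence identifies the limit as \<open>d\<close> tends to \<open>0\<close>.\<close>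

section \<open>Endpoints of the levels\<close>

text \<open>Mere continuity of \<open>f\<close> gives no contraction estimate, so iterating the
  undelayed equation need not converge; and \<open>fuzzy\<close> is a metric space with a sum and a
  scaling but not a normed space, so Schauder's theorem does not apply to it as it stands. The delay
  yields approximate solutions by finitely many iterations, and compactness is spent on removing the
  delay. The compactness of \<open>f\<close> enters through one set: \<open>G\<close> is bounded,
  hence the closure in \<open>RFc\<close> of its image under \<open>f\<close> is a compact set
  \<open>K\<close>. This set supplies the bound on the integrands and their common modulus in
  \<alpha>. As \<open>f\<close> lives on positive times only, the integrand has no controlled value
  at 0; the real estimates are therefore stated for functions continuous and bounded on an open
  interval. What Arzela-Ascoli produces is a pair of real functions; that the pair comes from fuzzy
  numbers rests on the reconstruction in \<open>exists_RFc_with_endpoints\<close>.\<close>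

definition level_lo :: "fuzzy \<Rightarrow> real \<Rightarrow> real" where
  "level_lo u \<alpha> = Inf (set_of_kc (level u \<alpha>))"

definition level_hi :: "fuzzy \<Rightarrow> real \<Rightarrow> real" where
  "level_hi u \<alpha> = Sup (set_of_kc (level u \<alpha>))"

lemma level_lo_le_hi: "level_lo u \<alpha> \<le> level_hi u \<alpha>"
  and set_of_kc_level_eq: "set_of_kc (level u \<alpha>) = {level_lo u \<alpha>..level_hi u \<alpha>}"
proof -
  obtain l r where "l \<le> r" "set_of_kc (level u \<alpha>) = {l..r}" using kc_interval .
  then show "level_lo u \<alpha> \<le> level_hi u \<alpha>"
    and "set_of_kc (level u \<alpha>) = {level_lo u \<alpha>..level_hi u \<alpha>}"
    by (auto simp: level_lo_def level_hi_def)
qed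

lemma level_endpoints_eqI:
  assumes "set_of_kc (level u \<alpha>) = {l..r}"
  shows "level_lo u \<alpha> = l" "level_hi u \<alpha> = r"
proof -
  have "{level_lo u \<alpha>..level_hi u \<alpha>} = {l..r}" using assms set_of_kc_level_eq by simp
  then show "level_lo u \<alpha> = l" "level_hi u \<alpha> = r"
    using level_lo_le_hi[of u \<alpha>] by (auto simp: Icc_eq_Icc)
qed

lemma dist_level:
  "dist (level u \<alpha>) (level v \<beta>) = max \<bar>level_lo u \<alpha> - level_lo v \<beta>\<bar> \<bar>level_hi u \<alpha> - level_hi v \<beta>\<bar>"
  unfolding dist_kc_def set_of_kc_level_eq
  by (intro hausdorff_dist_interval level_lo_le_hi)

lemma dist_level_le_dist: "\<alpha> \<in> {0..1} \<Longrightarrow> dist (level u \<alpha>) (level v \<alpha>) \<le> dist u v"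
  unfolding dist_fuzzy_def by (intro cSUP_upper bdd_above_dist_level)

lemma dist_fuzzy_le:
  assumes "\<And>\<alpha>. \<alpha> \<in> {0..1} \<Longrightarrow> \<bar>level_lo u \<alpha> - level_lo v \<alpha>\<bar> \<le> r"
    and "\<And>\<alpha>. \<alpha> \<in> {0..1} \<Longrightarrow> \<bar>level_hi u \<alpha> - level_hi v \<alpha>\<bar> \<le> r"
  shows "dist u v \<le> r"
  unfolding dist_fuzzy_def using assms by (intro cSUP_least) (auto simp: dist_level)

lemma fuzzy_eq_endpointsI:
  assumes "\<And>\<alpha>. \<alpha> \<in> {0..1} \<Longrightarrow> level_lo u \<alpha> = level_lo v \<alpha>"
    and "\<And>\<alpha>. \<alpha> \<in> {0..1} \<Longrightarrow> level_hi u \<alpha> = level_hi v \<alpha>"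
  shows "u = v"
  using assms by (intro fuzzy_eqI) (simp add: set_of_kc_level_eq flip: set_of_kc_inject)

lemma level_endpoints_plus:
  assumes "\<alpha> \<in> {0..1}"
  shows "level_lo (u + v) \<alpha> = level_lo u \<alpha> + level_lo v \<alpha>"
    "level_hi (u + v) \<alpha> = level_hi u \<alpha> + level_hi v \<alpha>"
proof -
  have "{x + y |x y. x \<in> {a..b} \<and> y \<in> {c..d}} = {a + c..b + d}"
    if "a \<le> b" "c \<le> d" for a b c d :: real
  proof (intro subset_antisym subsetI)
    fix z assume z: "z \<in> {a + c..b + d}"
    \<comment> \<open>The point \<open>z - c\<close> is clamped to [a, b]: either it lies there and
      the remainder is \<open>c\<close>, or it exceeds \<open>b\<close> and the remainder
      \<open>z - b\<close> lies in [c, d].\<close>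
    define x where "x = max a (min b (z - c))"
    have "x \<in> {a..b}" "z - x \<in> {c..d}" "z = x + (z - x)" using z that unfolding x_def by auto
    then show "z \<in> {x + y |x y. x \<in> {a..b} \<and> y \<in> {c..d}}" by blast
  qed auto
  then have "set_of_kc (level (u + v) \<alpha>) = {level_lo u \<alpha> + level_lo v \<alpha>..level_hi u \<alpha> + level_hi v \<alpha>}"
    unfolding level_plus[OF assms] set_of_kc_level_eq[of u] set_of_kc_level_eq[of v]
    by (simp add: level_lo_le_hi)
  then show "level_lo (u + v) \<alpha> = level_lo u \<alpha> + level_lo v \<alpha>"
    "level_hi (u + v) \<alpha> = level_hi u \<alpha> + level_hi v \<alpha>"
    by (rule level_endpoints_eqI)+
qed

text \<open>A nonnegative factor keeps the order of the endpoints; a negative one would exchange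
  them.\<close>

lemma level_endpoints_scaleR:
  assumes "\<alpha> \<in> {0..1}" "0 \<le> k"
  shows "level_lo (k *\<^sub>R u) \<alpha> = k * level_lo u \<alpha>"
    "level_hi (k *\<^sub>R u) \<alpha> = k * level_hi u \<alpha>"
proof -
  have "set_of_kc (level (k *\<^sub>R u) \<alpha>) = {k * level_lo u \<alpha>..k * level_hi u \<alpha>}"
    unfolding level_scaleR[OF assms(1)] set_of_kc_level_eq[of u]
    using assms level_lo_le_hi[of u \<alpha>] by (simp add: image_mult_atLeastAtMost_if)
  then show "level_lo (k *\<^sub>R u) \<alpha> = k * level_lo u \<alpha>"
    "level_hi (k *\<^sub>R u) \<alpha> = k * level_hi u \<alpha>"
    by (rule level_endpoints_eqI)+
qed

lemma level_endpoints_zero: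
  assumes "\<alpha> \<in> {0..1}"
  shows "level_lo 0 \<alpha> = 0" "level_hi 0 \<alpha> = 0"
proof -
  have "{t::real. (if t = 0 then 1 else 0) > (0::real)} = {0}" by auto
  moreover have "{t::real. (if t = 0 then 1 else 0) \<ge> \<alpha>} = {0}" if "\<alpha> \<noteq> 0" using assms that by auto
  ultimately have "set_of_kc (level 0 \<alpha>) = {0..0}"
    using assms by (simp add: set_of_kc_level level_set_def membership_zero)
  then show "level_lo 0 \<alpha> = 0" "level_hi 0 \<alpha> = 0"
    by (rule level_endpoints_eqI)+
qed

lemma abs_level_endpoints_le_dist:
  assumes "\<alpha> \<in> {0..1}"
  shows "\<bar>level_lo u \<alpha>\<bar> \<le> dist u 0" "\<bar>level_hi u \<alpha>\<bar> \<le> dist u 0"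
  using dist_level_le_dist[OF assms, of u 0] assms by (auto simp: dist_level level_endpoints_zero)

lemma level_endpoints_mono:
  assumes "0 \<le> \<alpha>" "\<alpha> \<le> \<beta>" "\<beta> \<le> 1"
  shows "level_lo u \<alpha> \<le> level_lo u \<beta>" "level_hi u \<beta> \<le> level_hi u \<alpha>"
proof -
  have "set_of_kc (level u \<beta>) \<subseteq> set_of_kc (level u \<alpha>)"
    using level_set_antimono[OF is_fuzzy_number_membership assms(1,2)] assms by (simp add: set_of_kc_level)
  then show "level_lo u \<alpha> \<le> level_lo u \<beta>" "level_hi u \<beta> \<le> level_hi u \<alpha>"
    unfolding set_of_kc_level_eq using level_lo_le_hi[of u \<beta>] by auto
qed

lemma continuous_on_level_iff:
  "continuous_on S (level u) \<longleftrightarrow> continuous_on S (level_lo u) \<and> continuous_on S (level_hi u)"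
proof
  assume u: "continuous_on S (level u)"
  have "dist (level_lo u \<alpha>) (level_lo u \<beta>) \<le> dist (level u \<alpha>) (level u \<beta>)"
    "dist (level_hi u \<alpha>) (level_hi u \<beta>) \<le> dist (level u \<alpha>) (level u \<beta>)" for \<alpha> \<beta>
    by (simp_all add: dist_level dist_real_def)
  with u show "continuous_on S (level_lo u) \<and> continuous_on S (level_hi u)"
    unfolding continuous_on_iff by (meson order.strict_trans1)
next
  assume u: "continuous_on S (level_lo u) \<and> continuous_on S (level_hi u)"
  show "continuous_on S (level u)"
    unfolding continuous_on_iff
  proof (intro ballI allI impI)
    fix x and e :: real assume x: "x \<in> S" "0 < e"
    obtain d\<^sub>1 where "d\<^sub>1 > 0" "\<And>y. y \<in> S \<Longrightarrow> dist y x < d\<^sub>1 \<Longrightarrow> dist (level_lo u y) (level_lo u x) < e"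
      using u x unfolding continuous_on_iff by metis
    moreover obtain d\<^sub>2 where "d\<^sub>2 > 0" "\<And>y. y \<in> S \<Longrightarrow> dist y x < d\<^sub>2 \<Longrightarrow> dist (level_hi u y) (level_hi u x) < e"
      using u x unfolding continuous_on_iff by metis
    ultimately show "\<exists>d>0. \<forall>y\<in>S. dist y x < d \<longrightarrow> dist (level u y) (level u x) < e"
      by (intro exI[of _ "min d\<^sub>1 d\<^sub>2"]) (auto simp: dist_level dist_real_def)
  qed
qed

section \<open>Membership in \<open>RFc\<close>, and compact subsets of it\<close>

lemma zero_in_RFc: "0 \<in> RFc"
  unfolding RFc_def continuous_on_level_iff
  by (auto intro: continuous_on_eq[OF continuous_on_const[of _ 0]] simp: level_endpoints_zero)

lemma plus_scaleR_in_RFc: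
  assumes "u \<in> RFc" "v \<in> RFc" "0 \<le> k"
  shows "u + k *\<^sub>R v \<in> RFc"
proof -
  have "continuous_on {0..1} (\<lambda>\<alpha>. level_lo u \<alpha> + k * level_lo v \<alpha>)"
    "continuous_on {0..1} (\<lambda>\<alpha>. level_hi u \<alpha> + k * level_hi v \<alpha>)"
    using assms by (auto simp: RFc_def continuous_on_level_iff intro!: continuous_intros)
  then have "continuous_on {0..1} (level_lo (u + k *\<^sub>R v))" "continuous_on {0..1} (level_hi (u + k *\<^sub>R v))"
    using assms(3) by (simp_all add: level_endpoints_plus level_endpoints_scaleR cong: continuous_on_cong_simp)
  then show ?thesis by (simp add: RFc_def continuous_on_level_iff)
qed

text \<open>Converse of the passage to endpoints, needed to build integrals and limits. The
  membership at \<open>t\<close> is the largest level whose interval contains \<open>t\<close>.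
  Continuity of \<open>l\<close> and \<open>r\<close> makes the supremum attained, and continuity at
  0 identifies level 0, which is defined by a closure and not by an inequality.\<close>

lemma exists_RFc_with_endpoints:
  fixes l r :: "real \<Rightarrow> real"
  assumes cont: "continuous_on {0..1} l" "continuous_on {0..1} r"
    and mono: "\<And>\<alpha> \<beta>. 0 \<le> \<alpha> \<Longrightarrow> \<alpha> \<le> \<beta> \<Longrightarrow> \<beta> \<le> 1 \<Longrightarrow> l \<alpha> \<le> l \<beta>"
      "\<And>\<alpha> \<beta>. 0 \<le> \<alpha> \<Longrightarrow> \<alpha> \<le> \<beta> \<Longrightarrow> \<beta> \<le> 1 \<Longrightarrow> r \<beta> \<le> r \<alpha>"
    and le: "l 1 \<le> r 1"
  obtains w where "w \<in> RFc" "\<And>\<alpha>. \<alpha> \<in> {0..1} \<Longrightarrow> level_lo w \<alpha> = l \<alpha>"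
    "\<And>\<alpha>. \<alpha> \<in> {0..1} \<Longrightarrow> level_hi w \<alpha> = r \<alpha>"
proof -
  \<comment> \<open>The inserted 0 gives membership 0 to points outside every interval and keeps the
    set nonempty.\<close>
  define A where "A t = insert 0 {\<alpha>\<in>{0..1}. l \<alpha> \<le> t \<and> t \<le> r \<alpha>}" for t
  define u where "u t = Sup (A t)" for t
  have lr: "l \<alpha> \<le> r \<alpha>" if "\<alpha> \<in> {0..1}" for \<alpha>
    using mono[of \<alpha> 1] le that by force
  have A01: "A t \<subseteq> {0..1}" "0 \<in> A t" for t by (auto simp: A_def)
  then have bdd: "bdd_above (A t)" for t by (meson bdd_above_Icc bdd_above_mono)
  have u01: "0 \<le> u t" "u t \<le> 1" for t
    using A01[of t] bdd[of t] unfolding u_def by (auto intro!: cSup_upper cSup_least)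
  have closedA: "closed {\<alpha>\<in>{0..1}. l \<alpha> \<le> t \<and> t \<le> r \<alpha>}" for t
  proof -
    have "closed ({0..1} \<inter> l -` {..t})" "closed ({0..1} \<inter> r -` {t..})"
      using cont by (intro continuous_closed_preimage; simp)+
    then have "closed (({0..1} \<inter> l -` {..t}) \<inter> ({0..1} \<inter> r -` {t..}))" by (rule closed_Int)
    moreover have "({0..1} \<inter> l -` {..t}) \<inter> ({0..1} \<inter> r -` {t..}) = {\<alpha>\<in>{0..1}. l \<alpha> \<le> t \<and> t \<le> r \<alpha>}"
      by auto
    ultimately show ?thesis by simp
  qed
  have uA: "u t \<in> A t" for t
    unfolding u_def using closedA[of t] A01[of t] bdd[of t]
    by (intro closed_contains_Sup) (auto simp: A_def)
  \<comment> \<open>Since the supremum is attained, \<open>\<alpha> \<le> u t\<close> with positive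
    \<alpha> puts \<open>t\<close> into the interval at level \<open>u t\<close>, which is contained
    in the one at \<alpha>.\<close>
  have ge: "\<alpha> \<le> u t \<longleftrightarrow> l \<alpha> \<le> t \<and> t \<le> r \<alpha>" if "\<alpha> \<in> {0<..1}" for \<alpha> t
  proof
    assume "\<alpha> \<le> u t"
    then show "l \<alpha> \<le> t \<and> t \<le> r \<alpha>"
      using uA[of t] that mono[of \<alpha> "u t"] by (auto simp: A_def)
  next
    assume "l \<alpha> \<le> t \<and> t \<le> r \<alpha>"
    then show "\<alpha> \<le> u t" using that bdd unfolding u_def by (intro cSup_upper) (auto simp: A_def)
  qed
  have pos_sub: "{t. 0 < u t} \<subseteq> {l 0..r 0}"
  proof clarify
    fix t assume "0 < u t"
    then have "l (u t) \<le> t" "t \<le> r (u t)" using uA[of t] by (auto simp: A_def)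
    then show "t \<in> {l 0..r 0}" using mono[of 0 "u t"] u01[of t] by auto
  qed
  have fz: "is_fuzzy_number u"
    unfolding is_fuzzy_number_def upper_semicont_iff_closed
  proof (intro conjI allI ballI)
    show "range u \<subseteq> {0..1}" using u01 by auto
    have "u (l 1) = 1" using ge[of 1 "l 1"] u01(2)[of "l 1"] le by simp
    then show "\<exists>t\<^sub>0. u t\<^sub>0 = 1" ..
    fix s t p :: real assume p: "p \<in> {0..1}"
    let ?m = "min (u s) (u t)"
    show "?m \<le> u (p * s + (1 - p) * t)"
    proof (cases "?m > 0")
      case True
      then have m: "?m \<in> {0<..1}" using u01[of s] by auto
      have "l ?m \<le> s \<and> s \<le> r ?m" "l ?m \<le> t \<and> t \<le> r ?m" using ge[OF m] by (meson min.cobounded1 min.cobounded2)+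
      then have "s \<in> {l ?m..r ?m}" "t \<in> {l ?m..r ?m}" by auto
      then have "p *\<^sub>R s + (1 - p) *\<^sub>R t \<in> {l ?m..r ?m}"
        using p by (intro convexD[OF convex_real_interval(5)]) auto
      then show ?thesis unfolding ge[OF m] by auto
    next
      case False
      then show ?thesis using u01(1)[of "p * s + (1 - p) * t"] by linarith
    qed
  next
    fix c :: real
    consider "c \<le> 0" | "c \<in> {0<..1}" | "c > 1" by (meson greaterThanAtMost_iff not_le)
    then show "closed {t. c \<le> u t}"
    proof cases
      case 1
      then have "{t. c \<le> u t} = UNIV" using u01(1) order_trans by auto
      then show ?thesis by simp
    next
      case 2
      then have "{t. c \<le> u t} = {l c..r c}" by (auto simp: ge)
      then show ?thesis by simp
    next
      case 3
      then have "{t. c \<le> u t} = {}" using u01(2) by (auto simp: not_le intro: order.strict_trans1)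
      then show ?thesis by simp
    qed
    show "compact (closure {t. 0 < u t})"
      using bounded_subset[OF bounded_closed_interval pos_sub] by simp
  qed
  have pos: "level_set u \<alpha> = {l \<alpha>..r \<alpha>}" if "\<alpha> \<in> {0<..1}" for \<alpha>
    using that by (auto simp: level_set_def ge)
  have zero: "level_set u 0 = {l 0..r 0}"
  proof
    show "level_set u 0 \<subseteq> {l 0..r 0}" using pos_sub by (simp add: level_set_def closure_minimal)
    let ?x = "\<lambda>n. inverse (real (Suc n))"
    have x: "?x n \<in> {0<..1}" for n by (auto simp: field_simps)
    have lim: "(\<lambda>n. g (?x n)) \<longlonglongrightarrow> g 0" if "continuous_on {0..1} g" for g :: "real \<Rightarrow> real"
    proof (rule continuous_on_tendsto_compose[OF that LIMSEQ_inverse_real_of_nat])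
      show "\<forall>\<^sub>F n in sequentially. ?x n \<in> {0..1}"
        using x by (intro always_eventually allI) (simp add: less_imp_le)
    qed simp
    show "{l 0..r 0} \<subseteq> level_set u 0"
    proof
      fix t assume t: "t \<in> {l 0..r 0}"
      \<comment> \<open>Clamping \<open>t\<close> to the intervals at the positive levels
        \<open>?x n\<close> gives points of positive membership; they tend to \<open>t\<close>
        because these intervals tend to \<open>{l 0..r 0}\<close>.\<close>
      define y where "y n = max (l (?x n)) (min (r (?x n)) t)" for n
      have "y n \<in> {t. 0 < u t}" for n
      proof -
        have "l (?x n) \<le> y n \<and> y n \<le> r (?x n)" using lr[of "?x n"] x[of n] by (auto simp: y_def)
        then have "?x n \<le> u (y n)" using ge[OF x] by blast
        moreover have "0 < ?x n" using x[of n] by (simp only: greaterThanAtMost_iff)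
        ultimately show ?thesis by (simp only: mem_Collect_eq order.strict_trans2)
      qed
      moreover have "y \<longlonglongrightarrow> max (l 0) (min (r 0) t)"
        unfolding y_def by (intro tendsto_max tendsto_min lim cont tendsto_const)
      moreover have "max (l 0) (min (r 0) t) = t" using t by auto
      ultimately have "t \<in> closure {t. 0 < u t}"
        unfolding closure_sequential by (intro exI[of _ y]) simp
      then show "t \<in> level_set u 0" by (simp add: level_set_def)
    qed
  qed
  define w where "w = Fuzzy u"
  have "set_of_kc (level w \<alpha>) = {l \<alpha>..r \<alpha>}" if "\<alpha> \<in> {0..1}" for \<alpha>
    using that pos[of \<alpha>] zero by (cases "\<alpha> = 0") (auto simp: set_of_kc_level w_def Fuzzy_inverse fz)
  then have ends: "level_lo w \<alpha> = l \<alpha>" "level_hi w \<alpha> = r \<alpha>" if "\<alpha> \<in> {0..1}" for \<alpha>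
    using that by (blast intro: level_endpoints_eqI)+
  have "w \<in> RFc" unfolding RFc_def continuous_on_level_iff
    using cont by (simp add: ends cong: continuous_on_cong_simp)
  with ends show thesis using that by blast
qed

text \<open>Evaluating \<open>level x \<alpha>\<close> is jointly continuous on the product of
  \<open>K\<close> and [0, 1], being 1-Lipschitz in \<open>x\<close> uniformly in \<alpha>. Uniform
  continuity on this compact product, applied to two pairs with the same \<open>x\<close>, is the
  common modulus.\<close>

lemma compact_RFc_equicontinuous:
  assumes "compact K" "K \<subseteq> RFc" "0 < e"
  obtains d where "0 < d" "\<And>x \<alpha> \<beta>. x \<in> K \<Longrightarrow> \<alpha> \<in> {0..1} \<Longrightarrow> \<beta> \<in> {0..1} \<Longrightarrow> \<bar>\<alpha> - \<beta>\<bar> < d \<Longrightarrow>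
    dist (level x \<alpha>) (level x \<beta>) < e"
proof -
  have "continuous_on (K \<times> {0..1}) (\<lambda>p. level (fst p) (snd p))"
    unfolding continuous_on_iff
  proof (intro ballI allI impI)
    fix p :: "fuzzy \<times> real" and e :: real assume p: "p \<in> K \<times> {0..1}" "0 < e"
    have "continuous_on {0..1} (level (fst p))" using p assms by (auto simp: RFc_def)
    then obtain d where d: "d > 0"
      "\<And>\<beta>. \<beta> \<in> {0..1} \<Longrightarrow> dist \<beta> (snd p) < d \<Longrightarrow> dist (level (fst p) \<beta>) (level (fst p) (snd p)) < e / 2"
      using p unfolding continuous_on_iff by (metis half_gt_zero mem_Times_iff)
    show "\<exists>d>0. \<forall>p'\<in>K \<times> {0..1}. dist p' p < d \<longrightarrow> dist (level (fst p') (snd p')) (level (fst p) (snd p)) < e"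
    proof (intro exI[of _ "min d (e / 2)"] conjI ballI impI)
      fix p' assume p': "p' \<in> K \<times> {0..1}" "dist p' p < min d (e / 2)"
      then have "dist (fst p') (fst p) < e / 2" "dist (snd p') (snd p) < d"
        using dist_fst_le[of p' p] dist_snd_le[of p' p] by auto
      moreover have "dist (level (fst p') (snd p')) (level (fst p) (snd p')) \<le> dist (fst p') (fst p)"
        using p' by (intro dist_level_le_dist) auto
      ultimately show "dist (level (fst p') (snd p')) (level (fst p) (snd p)) < e"
        using d(2)[of "snd p'"] p' dist_triangle[of "level (fst p') (snd p')" "level (fst p) (snd p)" "level (fst p) (snd p')"]
        by (auto simp: mem_Times_iff)
    qed (use d p in auto)
  qed
  moreover have "compact (K \<times> {0..1::real})" using assms by (intro compact_Times) auto
  ultimately have "uniformly_continuous_on (K \<times> {0..1}) (\<lambda>p. level (fst p) (snd p))"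
    by (rule compact_uniformly_continuous)
  then obtain d where "d > 0" and d: "\<And>p p'. p \<in> K \<times> {0..1} \<Longrightarrow> p' \<in> K \<times> {0..1} \<Longrightarrow> dist p' p < d \<Longrightarrow>
      dist (level (fst p') (snd p')) (level (fst p) (snd p)) < e"
    using \<open>0 < e\<close> unfolding uniformly_continuous_on_def by metis
  show thesis
  proof
    fix x \<alpha> \<beta> assume "x \<in> K" "\<alpha> \<in> {0..1}" "\<beta> \<in> {0..1}" "\<bar>\<alpha> - \<beta>\<bar> < d"
    then show "dist (level x \<alpha>) (level x \<beta>) < e"
      using d[of "(x, \<beta>)" "(x, \<alpha>)"] by (simp add: dist_Pair_Pair dist_real_def)
  qed fact
qed

section \<open>Estimates relating the endpoints to the metric\<close>

lemma level_lo_diff_le_dist: "\<alpha> \<in> {0..1} \<Longrightarrow> \<bar>level_lo u \<alpha> - level_lo v \<alpha>\<bar> \<le> dist u v"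
  and level_hi_diff_le_dist: "\<alpha> \<in> {0..1} \<Longrightarrow> \<bar>level_hi u \<alpha> - level_hi v \<alpha>\<bar> \<le> dist u v"
  using dist_level_le_dist[of \<alpha> u v] by (simp_all add: dist_level)

lemma tendsto_level_endpoints:
  assumes F: "(F \<longlongrightarrow> u) net" and \<alpha>: "\<alpha> \<in> {0..1}"
  shows "((\<lambda>x. level_lo (F x) \<alpha>) \<longlongrightarrow> level_lo u \<alpha>) net" "((\<lambda>x. level_hi (F x) \<alpha>) \<longlongrightarrow> level_hi u \<alpha>) net"
proof -
  have "\<forall>\<^sub>F x in net. dist (F x) u < e" if "0 < e" for e
    using F that by (rule tendstoD)
  then show "((\<lambda>x. level_lo (F x) \<alpha>) \<longlongrightarrow> level_lo u \<alpha>) net" "((\<lambda>x. level_hi (F x) \<alpha>) \<longlongrightarrow> level_hi u \<alpha>) net"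
    unfolding tendsto_iff dist_real_def
    by (blast intro: eventually_mono order.strict_trans1 level_lo_diff_le_dist[OF \<alpha>] level_hi_diff_le_dist[OF \<alpha>])+
qed

lemma continuous_on_level_endpoints:
  assumes "continuous_on T F" "\<alpha> \<in> {0..1}"
  shows "continuous_on T (\<lambda>s. level_lo (F s) \<alpha>)" "continuous_on T (\<lambda>s. level_hi (F s) \<alpha>)"
  using assms unfolding continuous_on_def by (auto intro: tendsto_level_endpoints)

lemma dist_plus_scaleR_le:
  fixes x y x' y' :: fuzzy
  assumes "0 \<le> k"
  shows "dist (x + k *\<^sub>R y) (x' + k *\<^sub>R y') \<le> dist x x' + k * dist y y'"
proof -
  have *: "\<bar>(a + k * b) - (a' + k * b')\<bar> \<le> dist x x' + k * dist y y'"
    if "\<bar>a - a'\<bar> \<le> dist x x'" "\<bar>b - b'\<bar> \<le> dist y y'" for a a' b b'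
  proof -
    have "\<bar>(a + k * b) - (a' + k * b')\<bar> = \<bar>(a - a') + k * (b - b')\<bar>" by (simp add: algebra_simps)
    also have "\<dots> \<le> \<bar>a - a'\<bar> + k * \<bar>b - b'\<bar>" using assms by (metis abs_mult abs_of_nonneg abs_triangle_ineq)
    also have "\<dots> \<le> dist x x' + k * dist y y'" using that assms by (intro add_mono mult_left_mono)
    finally show ?thesis .
  qed
  show ?thesis
    by (rule dist_fuzzy_le; simp only: level_endpoints_plus level_endpoints_scaleR assms;
        intro * level_lo_diff_le_dist level_hi_diff_le_dist)
qed

text \<open>\<open>fuzzy\<close> carries the operations without algebraic laws, so even such
  identities are read off from the endpoints.\<close>

lemma zero_plus_scaleR_zero: "(0 :: fuzzy) + k *\<^sub>R 0 = 0" if "0 \<le> k"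
  using that by (intro fuzzy_eq_endpointsI)
    (simp_all add: level_endpoints_plus level_endpoints_scaleR level_endpoints_zero)

lemma plus_scaleR_zero: "(u :: fuzzy) + k *\<^sub>R 0 = u" if "0 \<le> k"
  using that by (intro fuzzy_eq_endpointsI)
    (simp_all add: level_endpoints_plus level_endpoints_scaleR level_endpoints_zero)

section \<open>Fractional integrals of real functions\<close>

text \<open>The indicator extends the kernel by 0 to the whole line, so that kernels for different
  \<open>t\<close> can be subtracted over one measure space.\<close>

definition frac_kernel :: "real \<Rightarrow> real \<Rightarrow> real \<Rightarrow> real" where
  "frac_kernel q t s = indicator {0<..<t} s * (t - s) powr (q - 1)"

text \<open>The Riemann-Liouville integral of order \<open>q\<close> without its factor
  \<open>1 / Gamma q\<close>, which enters later as the constant \<open>c\<close>.\<close>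

definition frac_int :: "real \<Rightarrow> (real \<Rightarrow> real) \<Rightarrow> real \<Rightarrow> real" where
  "frac_int q \<phi> t = (\<integral>s. (t - s) powr (q - 1) * \<phi> s \<partial>lebesgue_on {0<..<t})"

text \<open>For \<open>q < 1\<close> the integrand blows up at \<open>s = t\<close>, but its
  antiderivative \<open>- ((t - s) powr q) / q\<close> is continuous there, so the fundamental
  theorem with derivatives in the interior applies. Nonnegativity turns gauge integrability into
  Lebesgue integrability.\<close>

lemma has_bochner_integral_powr_tail:
  fixes q a t :: real
  assumes "0 < q" "a \<le> t"
  shows "has_bochner_integral lebesgue (\<lambda>s. indicator {a<..<t} s * (t - s) powr (q - 1)) ((t - a) powr q / q)"
proof -
  have "((\<lambda>s. (t - s) powr (q - 1)) has_integral (- ((t - t) powr q) / q - (- ((t - a) powr q) / q))) {a..t}"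
  proof (rule fundamental_theorem_of_calculus_interior)
    show "continuous_on {a..t} (\<lambda>s. - ((t - s) powr q) / q)"
      using assms by (intro continuous_intros continuous_on_powr') auto
    fix s assume "s \<in> {a<..<t}"
    then show "((\<lambda>s. - ((t - s) powr q) / q) has_vector_derivative (t - s) powr (q - 1)) (at s)"
      using assms unfolding has_real_derivative_iff_has_vector_derivative[symmetric]
      by (auto intro!: derivative_eq_intros)
  qed fact
  then have int: "((\<lambda>s. (t - s) powr (q - 1)) has_integral ((t - a) powr q / q)) {a<..<t}"
    using assms by (simp add: has_integral_Icc_iff_Ioo)
  then have abs: "(\<lambda>s. (t - s) powr (q - 1)) absolutely_integrable_on {a<..<t}"
    by (intro nonnegative_absolutely_integrable_1) auto
  then have "(LINT s:{a<..<t}|lebesgue. (t - s) powr (q - 1)) = (t - a) powr q / q"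
    using int by (simp add: set_lebesgue_integral_eq_integral integral_unique)
  with abs show ?thesis
    by (simp add: has_bochner_integral_iff set_integrable_def set_lebesgue_integral_def)
qed

lemma frac_kernel_integral:
  assumes "0 < q" "0 \<le> t"
  shows "integrable lebesgue (frac_kernel q t)" "integral\<^sup>L lebesgue (frac_kernel q t) = t powr q / q"
  using has_bochner_integral_powr_tail[OF assms]
  by (simp_all add: has_bochner_integral_iff frac_kernel_def[abs_def])

text \<open>As \<open>q < 1\<close>, the kernel at a fixed \<open>s < t\<close> decreases when
  \<open>t\<close> grows. The absolute value is thus the signed difference plus twice the part of
  the later kernel on (t, t'); the signed part contributes
  \<open>t powr q / q - t' powr q / q\<close>, which is at most 0.\<close>

lemma frac_kernel_diff_integral:
  assumes "0 < q" "q < 1" "0 \<le> t" "t \<le> t'"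
  shows "(\<integral>s. \<bar>frac_kernel q t s - frac_kernel q t' s\<bar> \<partial>lebesgue) \<le> 2 * (t' - t) powr q / q"
proof -
  let ?k = "\<lambda>s. indicator {t<..<t'} s * (t' - s) powr (q - 1)"
  have tail: "integrable lebesgue ?k" "integral\<^sup>L lebesgue ?k = (t' - t) powr q / q"
    using has_bochner_integral_powr_tail[OF assms(1,4)] by (simp_all add: has_bochner_integral_iff)
  have "0 \<le> t'" using assms by simp
  note k = frac_kernel_integral[OF assms(1,3)] frac_kernel_integral[OF assms(1) \<open>0 \<le> t'\<close>]
  \<comment> \<open>At \<open>s = t\<close> the first kernel and \<open>?k\<close> are 0 while the
    second kernel may be positive, so the identity can fail at this one point.\<close>
  have "AE s in lebesgue. s \<noteq> t"
    by (rule AE_completion) (rule AE_lborel_singleton)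
  then have "AE s in lebesgue. \<bar>frac_kernel q t s - frac_kernel q t' s\<bar> =
      frac_kernel q t s - frac_kernel q t' s + 2 * ?k s"
  proof eventually_elim
    case (elim s)
    have "(t' - s) powr (q - 1) \<le> (t - s) powr (q - 1)" if "s < t"
      using that assms by (intro powr_mono2') auto
    then show ?case using elim assms by (auto simp: frac_kernel_def indicator_def)
  qed
  moreover have "(\<lambda>s. \<bar>frac_kernel q t s - frac_kernel q t' s\<bar>) \<in> borel_measurable lebesgue"
    "(\<lambda>s. frac_kernel q t s - frac_kernel q t' s + 2 * ?k s) \<in> borel_measurable lebesgue"
    using k tail by (auto intro!: borel_measurable_integrable)
  ultimately have "(\<integral>s. \<bar>frac_kernel q t s - frac_kernel q t' s\<bar> \<partial>lebesgue) =
      (\<integral>s. frac_kernel q t s - frac_kernel q t' s + 2 * ?k s \<partial>lebesgue)"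
    by (intro integral_cong_AE)
  also have "\<dots> = t powr q / q - t' powr q / q + 2 * ((t' - t) powr q / q)"
    using k tail by simp
  also have "\<dots> \<le> 2 * (t' - t) powr q / q"
    using assms by (auto simp: divide_right_mono powr_mono2)
  finally show ?thesis .
qed

lemma frac_kernel_mult_integrable:
  fixes \<phi> :: "real \<Rightarrow> real"
  assumes "0 < q" "0 \<le> t" "t \<le> b" "continuous_on {0<..<b} \<phi>" "\<And>s. s \<in> {0<..<b} \<Longrightarrow> \<bar>\<phi> s\<bar> \<le> M"
  shows "integrable lebesgue (\<lambda>s. frac_kernel q t s * \<phi> s)"
proof (rule Bochner_Integration.integrable_bound)
  show "integrable lebesgue (\<lambda>s. frac_kernel q t s * M)"
    using frac_kernel_integral[OF assms(1,2)] by simp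
  \<comment> \<open>Nothing is known about \<phi> outside (0, b), not even measurability. Cutting it
    off there leaves the product unchanged, since the kernel vanishes outside (0, t).\<close>
  have "(\<lambda>s. indicator {0<..<b} s *\<^sub>R \<phi> s) \<in> borel_measurable borel"
    using assms(4) by (intro borel_measurable_continuous_on_indicator) auto
  then have "(\<lambda>s. indicator {0<..<b} s *\<^sub>R \<phi> s) \<in> borel_measurable lebesgue"
    by (simp add: measurable_completion)
  moreover have "frac_kernel q t \<in> borel_measurable lebesgue"
    using frac_kernel_integral[OF assms(1,2)] by (auto intro!: borel_measurable_integrable)
  ultimately have "(\<lambda>s. frac_kernel q t s * (indicator {0<..<b} s *\<^sub>R \<phi> s)) \<in> borel_measurable lebesgue"
    by (rule borel_measurable_times[rotated])
  also have "(\<lambda>s. frac_kernel q t s * (indicator {0<..<b} s *\<^sub>R \<phi> s)) = (\<lambda>s. frac_kernel q t s * \<phi> s)"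
    using assms by (auto simp: frac_kernel_def indicator_def)
  finally show "(\<lambda>s. frac_kernel q t s * \<phi> s) \<in> borel_measurable lebesgue" .
  show "AE s in lebesgue. norm (frac_kernel q t s * \<phi> s) \<le> norm (frac_kernel q t s * M)"
  proof (intro AE_I2)
    fix s
    show "norm (frac_kernel q t s * \<phi> s) \<le> norm (frac_kernel q t s * M)"
      using assms(5)[of s] assms(3)
      by (auto simp: frac_kernel_def indicator_def abs_mult intro!: mult_left_mono)
  qed
qed

lemma frac_int_eq: "frac_int q \<phi> t = (\<integral>s. frac_kernel q t s * \<phi> s \<partial>lebesgue)"
  unfolding frac_int_def by (subst integral_restrict_space) (auto simp: frac_kernel_def mult.assoc)

lemma frac_int_mono:
  fixes \<phi> \<psi> :: "real \<Rightarrow> real"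
  assumes "0 < q" "0 \<le> t" "t \<le> b"
    and "continuous_on {0<..<b} \<phi>" "\<And>s. s \<in> {0<..<b} \<Longrightarrow> \<bar>\<phi> s\<bar> \<le> M"
    and "continuous_on {0<..<b} \<psi>" "\<And>s. s \<in> {0<..<b} \<Longrightarrow> \<bar>\<psi> s\<bar> \<le> M"
    and "\<And>s. s \<in> {0<..<b} \<Longrightarrow> \<phi> s \<le> \<psi> s"
  shows "frac_int q \<phi> t \<le> frac_int q \<psi> t"
  unfolding frac_int_eq using assms
  by (intro integral_mono frac_kernel_mult_integrable[where b = b and M = M])
    (auto simp: frac_kernel_def indicator_def intro!: mult_left_mono)

lemma frac_int_diff_le:
  fixes \<phi> \<psi> :: "real \<Rightarrow> real"
  assumes "0 < q" "0 \<le> t" "t \<le> b"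
    and "continuous_on {0<..<b} \<phi>" "\<And>s. s \<in> {0<..<b} \<Longrightarrow> \<bar>\<phi> s\<bar> \<le> M"
    and "continuous_on {0<..<b} \<psi>" "\<And>s. s \<in> {0<..<b} \<Longrightarrow> \<bar>\<psi> s\<bar> \<le> M"
    and "\<And>s. s \<in> {0<..<b} \<Longrightarrow> \<bar>\<phi> s - \<psi> s\<bar> \<le> e"
  shows "\<bar>frac_int q \<phi> t - frac_int q \<psi> t\<bar> \<le> e * (t powr q / q)"
proof -
  note int = frac_kernel_mult_integrable[OF assms(1-5)] frac_kernel_mult_integrable[OF assms(1-3,6,7)]
  have "\<bar>frac_int q \<phi> t - frac_int q \<psi> t\<bar> = \<bar>\<integral>s. frac_kernel q t s * \<phi> s - frac_kernel q t s * \<psi> s \<partial>lebesgue\<bar>"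
    unfolding frac_int_eq using int by simp
  also have "\<dots> \<le> (\<integral>s. e * frac_kernel q t s \<partial>lebesgue)"
  proof (rule order_trans[OF integral_abs_bound integral_mono])
    fix s
    show "\<bar>frac_kernel q t s * \<phi> s - frac_kernel q t s * \<psi> s\<bar> \<le> e * frac_kernel q t s"
      using assms(8)[of s] assms(3)
      by (auto simp: frac_kernel_def indicator_def abs_mult mult.commute[of e] intro!: mult_left_mono
          simp flip: right_diff_distrib)
  qed (use int frac_kernel_integral[OF assms(1,2)] in auto)
  also have "\<dots> = e * (t powr q / q)" using frac_kernel_integral[OF assms(1,2)] by simp
  finally show ?thesis .
qed

lemma abs_frac_int_le:
  fixes \<phi> :: "real \<Rightarrow> real"
  assumes "0 < q" "0 \<le> t" "t \<le> b"
    and "continuous_on {0<..<b} \<phi>" "\<And>s. s \<in> {0<..<b} \<Longrightarrow> \<bar>\<phi> s\<bar> \<le> M" "0 \<le> M"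
  shows "\<bar>frac_int q \<phi> t\<bar> \<le> M * (t powr q / q)"
  using frac_int_diff_le[OF assms(1-5), of "\<lambda>_. 0" M] assms by (simp add: frac_int_eq)

text \<open>The estimate involves \<phi> only through \<open>M\<close>: all integrands with this
  bound share one Hoelder modulus of exponent \<open>q\<close>.\<close>

lemma frac_int_time_diff_le:
  fixes \<phi> :: "real \<Rightarrow> real"
  assumes "0 < q" "q < 1" "t \<in> {0..b}" "t' \<in> {0..b}"
    and "continuous_on {0<..<b} \<phi>" "\<And>s. s \<in> {0<..<b} \<Longrightarrow> \<bar>\<phi> s\<bar> \<le> M" "0 \<le> M"
  shows "\<bar>frac_int q \<phi> t - frac_int q \<phi> t'\<bar> \<le> M * (2 * \<bar>t - t'\<bar> powr q / q)"
proof -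
  have *: "\<bar>frac_int q \<phi> t - frac_int q \<phi> t'\<bar> \<le> M * (2 * (t' - t) powr q / q)"
    if "0 \<le> t" "t \<le> t'" "t' \<le> b" for t t'
  proof -
    have t: "t \<le> b" "0 \<le> t'" using that by auto
    note int = frac_kernel_mult_integrable[OF assms(1) that(1) t(1) assms(5,6)]
      frac_kernel_mult_integrable[OF assms(1) t(2) that(3) assms(5,6)]
    note k = frac_kernel_integral[OF assms(1) that(1)] frac_kernel_integral[OF assms(1) t(2)]
    have "\<bar>frac_int q \<phi> t - frac_int q \<phi> t'\<bar> = \<bar>\<integral>s. frac_kernel q t s * \<phi> s - frac_kernel q t' s * \<phi> s \<partial>lebesgue\<bar>"
      unfolding frac_int_eq using int by simp
    also have "\<dots> \<le> (\<integral>s. M * \<bar>frac_kernel q t s - frac_kernel q t' s\<bar> \<partial>lebesgue)"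
    proof (rule order_trans[OF integral_abs_bound integral_mono])
      fix s
      have "\<bar>frac_kernel q t s - frac_kernel q t' s\<bar> * \<bar>\<phi> s\<bar> \<le> \<bar>frac_kernel q t s - frac_kernel q t' s\<bar> * M"
      proof (cases "s \<in> {0<..<b}")
        case False
        then have "frac_kernel q t s = 0" "frac_kernel q t' s = 0"
          using that t by (auto simp: frac_kernel_def)
        then show ?thesis by simp
      qed (auto intro!: mult_left_mono assms(6))
      then show "\<bar>frac_kernel q t s * \<phi> s - frac_kernel q t' s * \<phi> s\<bar> \<le> M * \<bar>frac_kernel q t s - frac_kernel q t' s\<bar>"
        by (simp add: abs_mult mult.commute[of M] flip: left_diff_distrib)
    qed (use int k in auto)
    also have "\<dots> = M * (\<integral>s. \<bar>frac_kernel q t s - frac_kernel q t' s\<bar> \<partial>lebesgue)" by simp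
    also have "\<dots> \<le> M * (2 * (t' - t) powr q / q)"
      using frac_kernel_diff_integral[OF assms(1,2) that(1,2)] assms(7) by (intro mult_left_mono)
    finally show ?thesis .
  qed
  show ?thesis
    using *[of t t'] *[of t' t] assms(3,4) by (cases "t \<le> t'") (auto simp: abs_minus_commute)
qed

text \<open>Dominated convergence with majorant \<open>frac_kernel q t s * M\<close>; the pointwise
  convergence it asks for is what \<open>delayed_tendsto\<close> provides.\<close>

lemma frac_int_tendsto:
  fixes \<phi> :: "nat \<Rightarrow> real \<Rightarrow> real"
  assumes "0 < q" "0 \<le> t" "t \<le> b"
    and "\<And>n. continuous_on {0<..<b} (\<phi> n)" "\<And>n s. s \<in> {0<..<b} \<Longrightarrow> \<bar>\<phi> n s\<bar> \<le> M"
    and "continuous_on {0<..<b} \<psi>" "\<And>s. s \<in> {0<..<b} \<Longrightarrow> \<bar>\<psi> s\<bar> \<le> M"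
    and "\<And>s. s \<in> {0<..<b} \<Longrightarrow> (\<lambda>n. \<phi> n s) \<longlonglongrightarrow> \<psi> s"
  shows "(\<lambda>n. frac_int q (\<phi> n) t) \<longlonglongrightarrow> frac_int q \<psi> t"
  unfolding frac_int_eq
proof (rule integral_dominated_convergence)
  show "(\<lambda>s. frac_kernel q t s * \<psi> s) \<in> borel_measurable lebesgue"
    "(\<lambda>s. frac_kernel q t s * \<phi> n s) \<in> borel_measurable lebesgue" for n
    using assms by (auto intro!: borel_measurable_integrable frac_kernel_mult_integrable[where b = b and M = M])
  show "integrable lebesgue (\<lambda>s. frac_kernel q t s * M)"
    using frac_kernel_integral[OF assms(1,2)] by simp
  show "AE s in lebesgue. (\<lambda>n. frac_kernel q t s * \<phi> n s) \<longlonglongrightarrow> frac_kernel q t s * \<psi> s"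
  proof (intro AE_I2)
    fix s show "(\<lambda>n. frac_kernel q t s * \<phi> n s) \<longlonglongrightarrow> frac_kernel q t s * \<psi> s"
      using assms(3) assms(8)[of s] by (cases "s \<in> {0<..<t}") (auto simp: frac_kernel_def intro!: tendsto_mult_left)
  qed
  show "AE s in lebesgue. norm (frac_kernel q t s * \<phi> n s) \<le> frac_kernel q t s * M" for n
  proof (intro AE_I2)
    fix s show "norm (frac_kernel q t s * \<phi> n s) \<le> frac_kernel q t s * M"
      using assms(3) assms(5)[of s n] by (auto simp: frac_kernel_def indicator_def abs_mult intro!: mult_left_mono)
  qed
qed

section \<open>Fractional integrals of fuzzy functions\<close>

lemma is_fuzzy_integral_cong:
  assumes "\<And>s. s \<in> T \<Longrightarrow> F s = G s"
  shows "is_fuzzy_integral T F v \<longleftrightarrow> is_fuzzy_integral T G v"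
  using assms by (simp add: is_fuzzy_integral_def aumann_integral_def)

lemma fuzzy_integral_cong:
  assumes "\<And>s. s \<in> T \<Longrightarrow> F s = G s"
  shows "fuzzy_integral T F = fuzzy_integral T G"
  using is_fuzzy_integral_cong[OF assms] by (simp add: fuzzy_integral_def)

text \<open>A measurable selection is squeezed between the integrable endpoints, and so is its
  integral. Conversely, a value between the two integrals is a convex combination of them, and the
  same combination of \<open>l\<close> and \<open>r\<close> is a selection with that
  integral.\<close>

lemma aumann_integral_interval:
  fixes l r :: "real \<Rightarrow> real"
  assumes "integrable (lebesgue_on T) l" "integrable (lebesgue_on T) r" "\<And>s. s \<in> T \<Longrightarrow> l s \<le> r s"
    and T: "T \<in> sets lebesgue"
  shows "aumann_integral T (\<lambda>s. {l s..r s}) = {integral\<^sup>L (lebesgue_on T) l..integral\<^sup>L (lebesgue_on T) r}"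
proof (intro subset_antisym subsetI)
  fix x assume "x \<in> aumann_integral T (\<lambda>s. {l s..r s})"
  then obtain g where g: "g \<in> borel_measurable (lebesgue_on T)" "\<And>s. s \<in> T \<Longrightarrow> l s \<le> g s \<and> g s \<le> r s"
    and x: "x = integral\<^sup>L (lebesgue_on T) g"
    by (auto simp: aumann_integral_def)
  have "integrable (lebesgue_on T) g"
  proof (rule Bochner_Integration.integrable_bound)
    show "integrable (lebesgue_on T) (\<lambda>s. \<bar>l s\<bar> + \<bar>r s\<bar>)" using assms by auto
    show "AE s in lebesgue_on T. norm (g s) \<le> norm (\<bar>l s\<bar> + \<bar>r s\<bar>)"
      using g(2) by (intro AE_I2) fastforce
  qed fact
  then show "x \<in> {integral\<^sup>L (lebesgue_on T) l..integral\<^sup>L (lebesgue_on T) r}"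
    unfolding x using assms g(2) by (auto intro!: integral_mono)
next
  fix x assume x: "x \<in> {integral\<^sup>L (lebesgue_on T) l..integral\<^sup>L (lebesgue_on T) r}"
  then have "x \<in> closed_segment (integral\<^sup>L (lebesgue_on T) l) (integral\<^sup>L (lebesgue_on T) r)"
    by (simp add: closed_segment_eq_real_ivl)
  then obtain p where p: "0 \<le> p" "p \<le> 1"
    "x = (1 - p) * integral\<^sup>L (lebesgue_on T) l + p * integral\<^sup>L (lebesgue_on T) r"
    by (auto simp: closed_segment_def)
  let ?g = "\<lambda>s. (1 - p) * l s + p * r s"
  have "?g s \<in> {l s..r s}" if "s \<in> T" for s
    using convexD[OF convex_real_interval(5)[of "l s" "r s"], of "l s" "r s" "1 - p" p] assms(3)[OF that] p by auto
  moreover have "x = integral\<^sup>L (lebesgue_on T) ?g" using p assms by simp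
  moreover have "?g \<in> borel_measurable (lebesgue_on T)" using assms by (auto intro!: borel_measurable_integrable)
  ultimately show "x \<in> aumann_integral T (\<lambda>s. {l s..r s})"
    unfolding aumann_integral_def by blast
qed

lemma strongly_measurable_continuous_on:
  assumes "continuous_on T F" "T \<in> sets lebesgue"
  shows "strongly_measurable T F"
  unfolding strongly_measurable_def
proof
  fix \<alpha> :: real assume "\<alpha> \<in> {0..1}"
  then have "continuous_on T (\<lambda>t. level (F t) \<alpha>)"
    using assms(1) unfolding continuous_on_iff by (meson dist_level_le_dist order.strict_trans1)
  then show "(\<lambda>t. level (F t) \<alpha>) \<in> borel_measurable (lebesgue_on T)"
    using assms(2) by (rule continuous_imp_measurable_on_sets_lebesgue)
qed

text \<open>Used for the measurability of the kernel times \<open>F\<close>. With \<open>y\<close>,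
  \<open>z\<close> endpoints of \<open>F x\<close>, \<open>F s\<close>, the splitting
  \<open>k x * y - k s * z = k x * (y - z) + (k x - k s) * z\<close> gives a majorant that is
  uniform in the level and tends to 0.\<close>

lemma continuous_on_fuzzy_scaleR:
  fixes F :: "real \<Rightarrow> fuzzy" and k :: "real \<Rightarrow> real"
  assumes "continuous_on T F" "continuous_on T k" "\<And>s. s \<in> T \<Longrightarrow> 0 \<le> k s"
  shows "continuous_on T (\<lambda>s. k s *\<^sub>R F s)"
  unfolding continuous_on_def
proof
  fix s assume s: "s \<in> T"
  have lim: "((\<lambda>x. k x * dist (F x) (F s) + \<bar>k x - k s\<bar> * dist (F s) 0) \<longlongrightarrow> k s * 0 + 0 * dist (F s) 0) (at s within T)"
    using assms(1,2) s
    by (intro tendsto_intros) (auto simp: continuous_on_def tendsto_dist_iff[of F] LIM_zero_iff intro!: tendsto_rabs_zero)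
  have "dist (k x *\<^sub>R F x) (k s *\<^sub>R F s) \<le> k x * dist (F x) (F s) + \<bar>k x - k s\<bar> * dist (F s) 0"
    if "x \<in> T" for x
  proof -
    have *: "\<bar>k x * y - k s * z\<bar> \<le> k x * dist (F x) (F s) + \<bar>k x - k s\<bar> * dist (F s) 0"
      if "\<bar>y - z\<bar> \<le> dist (F x) (F s)" "\<bar>z\<bar> \<le> dist (F s) 0" for y z
    proof -
      have "k x * y - k s * z = k x * (y - z) + (k x - k s) * z" by (simp add: algebra_simps)
      also have "\<bar>\<dots>\<bar> \<le> \<bar>k x\<bar> * \<bar>y - z\<bar> + \<bar>k x - k s\<bar> * \<bar>z\<bar>" by (metis abs_mult abs_triangle_ineq)
      also have "\<dots> \<le> k x * dist (F x) (F s) + \<bar>k x - k s\<bar> * dist (F s) 0"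
        using that assms(3)[OF \<open>x \<in> T\<close>] by (intro add_mono) (auto intro: mult_left_mono)
      finally show ?thesis .
    qed
    show ?thesis
    proof (rule dist_fuzzy_le)
      fix \<alpha> :: real assume \<alpha>: "\<alpha> \<in> {0..1}"
      have "\<bar>level_lo (F x) \<alpha> - level_lo (F s) \<alpha>\<bar> \<le> dist (F x) (F s)"
        "\<bar>level_hi (F x) \<alpha> - level_hi (F s) \<alpha>\<bar> \<le> dist (F x) (F s)"
        using dist_level_le_dist[OF \<alpha>, of "F x" "F s"] by (simp_all add: dist_level)
      then show "\<bar>level_lo (k x *\<^sub>R F x) \<alpha> - level_lo (k s *\<^sub>R F s) \<alpha>\<bar> \<le> k x * dist (F x) (F s) + \<bar>k x - k s\<bar> * dist (F s) 0"
        "\<bar>level_hi (k x *\<^sub>R F x) \<alpha> - level_hi (k s *\<^sub>R F s) \<alpha>\<bar> \<le> k x * dist (F x) (F s) + \<bar>k x - k s\<bar> * dist (F s) 0"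
        using assms(3) \<open>x \<in> T\<close> s \<alpha> abs_level_endpoints_le_dist[OF \<alpha>, of "F s"]
        by (auto simp: level_endpoints_scaleR intro!: *)
    qed
  qed
  note bound = this
  have "((\<lambda>x. dist (k x *\<^sub>R F x) (k s *\<^sub>R F s)) \<longlongrightarrow> 0) (at s within T)"
  proof (rule tendsto_sandwich[OF _ _ tendsto_const])
    show "\<forall>\<^sub>F x in at s within T. dist (k x *\<^sub>R F x) (k s *\<^sub>R F s)
        \<le> k x * dist (F x) (F s) + \<bar>k x - k s\<bar> * dist (F s) 0"
      unfolding eventually_at_filter by (intro always_eventually allI impI bound)
  qed (use lim in simp_all)
  then show "((\<lambda>x. k x *\<^sub>R F x) \<longlongrightarrow> k s *\<^sub>R F s) (at s within T)"
    by (simp only: tendsto_dist_iff[of _ "k s *\<^sub>R F s"])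
qed

lemma small_powr:
  fixes C q e :: real
  assumes "0 < q" "0 < e"
  obtains d where "0 < d" "\<And>h. \<bar>h\<bar> < d \<Longrightarrow> C * (\<bar>h\<bar> powr q) < e"
proof -
  have "continuous_on UNIV (\<lambda>h::real. C * (\<bar>h\<bar> powr q))"
    using assms by (intro continuous_intros continuous_on_powr') auto
  then obtain d where "d > 0" "\<And>h. dist h 0 < d \<Longrightarrow> dist (C * (\<bar>h\<bar> powr q)) (C * (\<bar>0\<bar> powr q)) < e"
    using assms(2) unfolding continuous_on_iff by (metis UNIV_I)
  then show thesis by (intro that[of d]) (auto simp: dist_real_def intro: le_less_trans[OF abs_ge_self])
qed

section \<open>The fractional integral of a fuzzy-valued function\<close>

definition frac_fuzzy :: "real \<Rightarrow> (real \<Rightarrow> fuzzy) \<Rightarrow> real \<Rightarrow> fuzzy" where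
  "frac_fuzzy q F t = fuzzy_integral {0<..<t} (\<lambda>s. (t - s) powr (q - 1) *\<^sub>R F s)"

lemma frac_fuzzy_cong: "(\<And>s. s \<in> {0<..<t} \<Longrightarrow> F s = G s) \<Longrightarrow> frac_fuzzy q F t = frac_fuzzy q G t"
  unfolding frac_fuzzy_def by (intro fuzzy_integral_cong) simp

text \<open>Besides a bound, the compact range \<open>K\<close> yields the modulus in \<alpha> from
  which continuity of the levels of the integral is derived; this modulus does not depend on
  \<open>F\<close>.\<close>

locale fuzzy_frac_integrand =
  fixes q b M :: real and K :: "fuzzy set" and F :: "real \<Rightarrow> fuzzy"
  assumes q: "0 < q" "q < 1" and M: "0 \<le> M"
    and K: "compact K" "K \<subseteq> RFc" "\<And>x. x \<in> K \<Longrightarrow> dist x 0 \<le> M"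
    and F: "continuous_on {0<..<b} F" "\<And>s. s \<in> {0<..<b} \<Longrightarrow> F s \<in> K"
begin

lemma
  assumes "\<alpha> \<in> {0..1}"
  shows continuous_lo: "continuous_on {0<..<b} (\<lambda>s. level_lo (F s) \<alpha>)"
    and continuous_hi: "continuous_on {0<..<b} (\<lambda>s. level_hi (F s) \<alpha>)"
    and bounded_lo: "\<And>s. s \<in> {0<..<b} \<Longrightarrow> \<bar>level_lo (F s) \<alpha>\<bar> \<le> M"
    and bounded_hi: "\<And>s. s \<in> {0<..<b} \<Longrightarrow> \<bar>level_hi (F s) \<alpha>\<bar> \<le> M"
  using continuous_on_level_endpoints[OF F(1) assms]
  by (auto intro!: order_trans[OF abs_level_endpoints_le_dist(1)[OF assms]] K(3) F(2)
      order_trans[OF abs_level_endpoints_le_dist(2)[OF assms]])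

text \<open>Integration multiplies an oscillation bound between two levels by
  \<open>t powr q / q\<close>, the mass of the kernel, for every \<open>F\<close> with values in
  \<open>K\<close>.\<close>

lemma frac_int_level_diff_le:
  assumes "t \<in> {0..b}" "\<alpha> \<in> {0..1}" "\<beta> \<in> {0..1}"
    and "\<And>x. x \<in> K \<Longrightarrow> dist (level x \<alpha>) (level x \<beta>) \<le> e"
  shows "\<bar>frac_int q (\<lambda>s. level_lo (F s) \<alpha>) t - frac_int q (\<lambda>s. level_lo (F s) \<beta>) t\<bar> \<le> e * (t powr q / q)"
    and "\<bar>frac_int q (\<lambda>s. level_hi (F s) \<alpha>) t - frac_int q (\<lambda>s. level_hi (F s) \<beta>) t\<bar> \<le> e * (t powr q / q)"
proof -
  have t: "0 \<le> t" "t \<le> b" using assms(1) by auto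
  have "\<bar>level_lo (F s) \<alpha> - level_lo (F s) \<beta>\<bar> \<le> e" "\<bar>level_hi (F s) \<alpha> - level_hi (F s) \<beta>\<bar> \<le> e"
    if "s \<in> {0<..<b}" for s using assms(4)[OF F(2)[OF that]] by (simp_all add: dist_level)
  then show "\<bar>frac_int q (\<lambda>s. level_lo (F s) \<alpha>) t - frac_int q (\<lambda>s. level_lo (F s) \<beta>) t\<bar> \<le> e * (t powr q / q)"
    and "\<bar>frac_int q (\<lambda>s. level_hi (F s) \<alpha>) t - frac_int q (\<lambda>s. level_hi (F s) \<beta>) t\<bar> \<le> e * (t powr q / q)"
    using frac_int_diff_le[OF q(1) t continuous_lo[OF assms(2)] bounded_lo[OF assms(2)]
        continuous_lo[OF assms(3)] bounded_lo[OF assms(3)]]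
      frac_int_diff_le[OF q(1) t continuous_hi[OF assms(2)] bounded_hi[OF assms(2)]
        continuous_hi[OF assms(3)] bounded_hi[OF assms(3)]]
    by blast+
qed

text \<open>The integrals of the endpoint functions get continuity in the level from the modulus of
  \<open>K\<close>, and monotonicity and order from the integrands. Hence they are the endpoints of
  a fuzzy number, which \<open>aumann_integral_interval\<close> identifies as the integral.\<close>

lemma exists_is_fuzzy_integral:
  assumes "t \<in> {0..b}"
  obtains w where "w \<in> RFc" "is_fuzzy_integral {0<..<t} (\<lambda>s. (t - s) powr (q - 1) *\<^sub>R F s) w"
    "\<And>\<alpha>. \<alpha> \<in> {0..1} \<Longrightarrow> level_lo w \<alpha> = frac_int q (\<lambda>s. level_lo (F s) \<alpha>) t"
    "\<And>\<alpha>. \<alpha> \<in> {0..1} \<Longrightarrow> level_hi w \<alpha> = frac_int q (\<lambda>s. level_hi (F s) \<alpha>) t"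
proof -
  have t: "0 \<le> t" "t \<le> b" using assms by auto
  let ?l = "\<lambda>\<alpha>. frac_int q (\<lambda>s. level_lo (F s) \<alpha>) t" and ?r = "\<lambda>\<alpha>. frac_int q (\<lambda>s. level_hi (F s) \<alpha>) t"
  have eq: "\<exists>d>0. \<forall>\<beta>\<in>{0..1}. dist \<beta> \<alpha> < d \<longrightarrow> dist (?l \<beta>) (?l \<alpha>) < e \<and> dist (?r \<beta>) (?r \<alpha>) < e"
    if \<alpha>: "\<alpha> \<in> {0..1}" and "0 < e" for \<alpha> e
  proof -
    \<comment> \<open>Adding 1 to the mass of the kernel avoids division by 0 at
      \<open>t = 0\<close> and makes \<open>e' * (t powr q / q) < e\<close> strict.\<close>
    define e' where "e' = e / (t powr q / q + 1)"
    have "0 < t powr q / q + 1" using q by (intro add_nonneg_pos) auto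
    then have "e' * (t powr q / q + 1) = e" and "e' > 0"
      using \<open>0 < e\<close> by (auto simp: e'_def)
    then have e': "e' > 0" "e' * (t powr q / q) < e" by (simp_all add: distrib_left)
    obtain d where d: "d > 0" "\<And>x \<alpha> \<beta>. x \<in> K \<Longrightarrow> \<alpha> \<in> {0..1} \<Longrightarrow> \<beta> \<in> {0..1} \<Longrightarrow> \<bar>\<alpha> - \<beta>\<bar> < d \<Longrightarrow>
        dist (level x \<alpha>) (level x \<beta>) < e'"
      using compact_RFc_equicontinuous[OF K(1,2) e'(1)] by blast
    show ?thesis
    proof (intro exI[of _ d] conjI ballI impI)
      fix \<beta> :: real assume \<beta>: "\<beta> \<in> {0..1}" "dist \<beta> \<alpha> < d"
      then have "dist (level x \<beta>) (level x \<alpha>) \<le> e'" if "x \<in> K" for x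
        using d(2)[OF that \<beta>(1) \<alpha>] by (simp add: dist_real_def)
      from frac_int_level_diff_le[OF assms \<beta>(1) \<alpha> this] e'(2)
      show "dist (?l \<beta>) (?l \<alpha>) < e" "dist (?r \<beta>) (?r \<alpha>) < e"
        by (simp_all add: dist_real_def)
    qed fact
  qed
  have mono: "frac_int q (\<lambda>s. level_lo (F s) \<alpha>) t \<le> frac_int q (\<lambda>s. level_lo (F s) \<beta>) t"
    "frac_int q (\<lambda>s. level_hi (F s) \<beta>) t \<le> frac_int q (\<lambda>s. level_hi (F s) \<alpha>) t"
    if "0 \<le> \<alpha>" "\<alpha> \<le> \<beta>" "\<beta> \<le> 1" for \<alpha> \<beta>
  proof -
    have \<alpha>: "\<alpha> \<in> {0..1}" and \<beta>: "\<beta> \<in> {0..1}" using that by auto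
    show "frac_int q (\<lambda>s. level_lo (F s) \<alpha>) t \<le> frac_int q (\<lambda>s. level_lo (F s) \<beta>) t"
      using that by (intro frac_int_mono[OF q(1) t continuous_lo[OF \<alpha>] bounded_lo[OF \<alpha>]
          continuous_lo[OF \<beta>] bounded_lo[OF \<beta>]] level_endpoints_mono)
    show "frac_int q (\<lambda>s. level_hi (F s) \<beta>) t \<le> frac_int q (\<lambda>s. level_hi (F s) \<alpha>) t"
      using that by (intro frac_int_mono[OF q(1) t continuous_hi[OF \<beta>] bounded_hi[OF \<beta>]
          continuous_hi[OF \<alpha>] bounded_hi[OF \<alpha>]] level_endpoints_mono)
  qed
  have one: "(1::real) \<in> {0..1}" by simp
  obtain w where w: "w \<in> RFc" "\<And>\<alpha>. \<alpha> \<in> {0..1} \<Longrightarrow> level_lo w \<alpha> = ?l \<alpha>" "\<And>\<alpha>. \<alpha> \<in> {0..1} \<Longrightarrow> level_hi w \<alpha> = ?r \<alpha>"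
  proof (rule exists_RFc_with_endpoints[of ?l ?r])
    show "continuous_on {0..1} ?l" "continuous_on {0..1} ?r"
      using eq unfolding continuous_on_iff by meson+
    show "?l 1 \<le> ?r 1"
      by (intro frac_int_mono[OF q(1) t continuous_lo[OF one] bounded_lo[OF one]
          continuous_hi[OF one] bounded_hi[OF one]] level_lo_le_hi)
  qed (use mono in auto)
  have "is_fuzzy_integral {0<..<t} (\<lambda>s. (t - s) powr (q - 1) *\<^sub>R F s) w"
    unfolding is_fuzzy_integral_def
  proof
    fix \<alpha> :: real assume \<alpha>: "\<alpha> \<in> {0..1}"
    have int: "integrable (lebesgue_on {0<..<t}) (\<lambda>s. (t - s) powr (q - 1) * \<phi> s)"
      if "integrable lebesgue (\<lambda>s. frac_kernel q t s * \<phi> s)" for \<phi>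
      using that by (subst integrable_restrict_space) (auto simp: frac_kernel_def mult.assoc)
    have "aumann_integral {0<..<t} (\<lambda>s. set_of_kc (level ((t - s) powr (q - 1) *\<^sub>R F s) \<alpha>)) =
      aumann_integral {0<..<t} (\<lambda>s. {(t - s) powr (q - 1) * level_lo (F s) \<alpha>..(t - s) powr (q - 1) * level_hi (F s) \<alpha>})"
      using \<alpha> by (simp add: set_of_kc_level_eq level_endpoints_scaleR)
    also have "\<dots> = {?l \<alpha>..?r \<alpha>}"
      unfolding frac_int_def
      by (intro aumann_integral_interval int mult_left_mono level_lo_le_hi
          frac_kernel_mult_integrable[OF q(1) t continuous_lo[OF \<alpha>] bounded_lo[OF \<alpha>]]
          frac_kernel_mult_integrable[OF q(1) t continuous_hi[OF \<alpha>] bounded_hi[OF \<alpha>]]) auto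
    finally show "set_of_kc (level w \<alpha>) = aumann_integral {0<..<t} (\<lambda>s. set_of_kc (level ((t - s) powr (q - 1) *\<^sub>R F s) \<alpha>))"
      using \<alpha> by (simp add: set_of_kc_level_eq w)
  qed
  with w show thesis using that by blast
qed

lemma frac_fuzzy_in_RFc: "t \<in> {0..b} \<Longrightarrow> frac_fuzzy q F t \<in> RFc"
  and level_lo_frac_fuzzy: "t \<in> {0..b} \<Longrightarrow> \<alpha> \<in> {0..1} \<Longrightarrow>
    level_lo (frac_fuzzy q F t) \<alpha> = frac_int q (\<lambda>s. level_lo (F s) \<alpha>) t"
  and level_hi_frac_fuzzy: "t \<in> {0..b} \<Longrightarrow> \<alpha> \<in> {0..1} \<Longrightarrow>
    level_hi (frac_fuzzy q F t) \<alpha> = frac_int q (\<lambda>s. level_hi (F s) \<alpha>) t"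
  unfolding frac_fuzzy_def by (metis exists_is_fuzzy_integral fuzzy_integral_eqI)+

lemma fuzzy_integrable_frac:
  assumes "t \<in> {0..b}"
  shows "fuzzy_integrable {0<..<t} (\<lambda>s. (t - s) powr (q - 1) *\<^sub>R F s)"
  unfolding fuzzy_integrable_def
proof (intro conjI)
  have "continuous_on {0<..<t} (\<lambda>s. (t - s) powr (q - 1) *\<^sub>R F s)"
    using assms F(1) by (intro continuous_on_fuzzy_scaleR continuous_intros) (auto elim: continuous_on_subset)
  then show "strongly_measurable {0<..<t} (\<lambda>s. (t - s) powr (q - 1) *\<^sub>R F s)"
    by (intro strongly_measurable_continuous_on) auto
  show "\<exists>v. is_fuzzy_integral {0<..<t} (\<lambda>s. (t - s) powr (q - 1) *\<^sub>R F s) v"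
    using exists_is_fuzzy_integral[OF assms] by metis
  have "integrable (lebesgue_on {0<..<t}) (\<lambda>s. (t - s) powr (q - 1) * M)"
    using frac_kernel_integral(1)[OF q(1), of t] assms
    by (subst integrable_restrict_space) (auto simp: frac_kernel_def[abs_def] simp flip: mult.assoc)
  moreover have "hausdorff_dist (set_of_kc (level ((t - s) powr (q - 1) *\<^sub>R F s) 0)) {0} \<le> (t - s) powr (q - 1) * M"
    if "s \<in> {0<..<t}" for s
  proof -
    have "\<bar>level_lo (F s) 0\<bar> \<le> M" "\<bar>level_hi (F s) 0\<bar> \<le> M"
      using bounded_lo[of 0 s] bounded_hi[of 0 s] that assms by auto
    then show ?thesis
      using hausdorff_dist_interval[OF level_lo_le_hi, of 0 0 "(t - s) powr (q - 1) *\<^sub>R F s" 0]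
      by (simp add: set_of_kc_level_eq level_endpoints_scaleR abs_mult mult_left_mono)
  qed
  ultimately show "integrably_bounded {0<..<t} (\<lambda>s. (t - s) powr (q - 1) *\<^sub>R F s)"
    unfolding integrably_bounded_def using M by (intro exI[of _ "\<lambda>s. (t - s) powr (q - 1) * M"]) auto
qed

lemma dist_frac_fuzzy_zero_le:
  assumes "t \<in> {0..b}"
  shows "dist (frac_fuzzy q F t) 0 \<le> M * (t powr q / q)"
proof -
  have t: "0 \<le> t" "t \<le> b" using assms by auto
  show ?thesis
    using abs_frac_int_le[OF q(1) t continuous_lo bounded_lo M] abs_frac_int_le[OF q(1) t continuous_hi bounded_hi M]
    by (intro dist_fuzzy_le)
      (simp_all add: level_lo_frac_fuzzy[OF assms] level_hi_frac_fuzzy[OF assms] level_endpoints_zero)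
qed

lemma dist_frac_fuzzy_le:
  assumes "t \<in> {0..b}" "t' \<in> {0..b}"
  shows "dist (frac_fuzzy q F t) (frac_fuzzy q F t') \<le> M * (2 * \<bar>t - t'\<bar> powr q / q)"
  using frac_int_time_diff_le[OF q assms continuous_lo bounded_lo M] frac_int_time_diff_le[OF q assms continuous_hi bounded_hi M]
  by (intro dist_fuzzy_le)
    (simp_all add: level_lo_frac_fuzzy[OF assms(1)] level_hi_frac_fuzzy[OF assms(1)]
      level_lo_frac_fuzzy[OF assms(2)] level_hi_frac_fuzzy[OF assms(2)])

lemma dist_level_frac_fuzzy_le:
  assumes "t \<in> {0..b}" "\<alpha> \<in> {0..1}" "\<beta> \<in> {0..1}"
    and "\<And>x. x \<in> K \<Longrightarrow> dist (level x \<alpha>) (level x \<beta>) \<le> e"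
  shows "dist (level (frac_fuzzy q F t) \<alpha>) (level (frac_fuzzy q F t) \<beta>) \<le> e * (t powr q / q)"
  using frac_int_level_diff_le[OF assms] assms
  by (simp add: dist_level level_lo_frac_fuzzy level_hi_frac_fuzzy)

text \<open>The bound \<open>M * (t powr q / q)\<close> is 0 at \<open>t = 0\<close>.\<close>

lemma frac_fuzzy_0: "0 \<le> b \<Longrightarrow> frac_fuzzy q F 0 = 0"
  using dist_frac_fuzzy_zero_le[of 0] q by simp

end

section \<open>The delayed equation\<close>

lemma dist_level_triangle:
  assumes "\<beta> \<in> {0..1}"
  shows "dist (level x \<alpha>) (level y \<beta>) \<le> dist x y + dist (level x \<alpha>) (level x \<beta>)"
  using dist_triangle[of "level x \<alpha>" "level y \<beta>" "level x \<beta>"] dist_level_le_dist[OF assms, of x y] by simp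

lemma norm_endpoints_le:
  fixes x y :: real
  assumes "\<bar>x\<bar> \<le> e" "\<bar>y\<bar> \<le> e"
  shows "norm (x, y) \<le> 2 * e"
  using norm_Pair_le[of x y] assms by simp

text \<open>Instantiated with \<eta> for \<open>b\<close>, \<open>1 / Gamma q\<close> for
  \<open>c\<close>, and the closure in \<open>RFc\<close> of the image of \<open>G\<close> for
  \<open>K\<close>. The last assumption makes the ball of radius \<open>R\<close> invariant under
  the integral operator.\<close>

locale fuzzy_frac_equation =
  fixes q b M c R :: real and K :: "fuzzy set" and u\<^sub>0 :: "real \<Rightarrow> fuzzy" and f :: "real \<times> fuzzy \<Rightarrow> fuzzy"
  assumes q: "0 < q" "q < 1" and b: "0 \<le> b" and M: "0 \<le> M" and c: "0 < c"
    and K: "compact K" "K \<subseteq> RFc" "\<And>x. x \<in> K \<Longrightarrow> dist x 0 \<le> M"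
    and u\<^sub>0: "continuous_on {0..b} u\<^sub>0" "\<And>t. t \<in> {0..b} \<Longrightarrow> u\<^sub>0 t \<in> RFc"
    and f: "continuous_on ({0<..b} \<times> RFc) f"
      "\<And>s x. s \<in> {0<..b} \<Longrightarrow> x \<in> RFc \<Longrightarrow> dist x 0 \<le> R \<Longrightarrow> f (s, x) \<in> K"
    and R: "\<And>t. t \<in> {0..b} \<Longrightarrow> dist (u\<^sub>0 t) 0 + c * (M * (b powr q / q)) \<le> R"
begin

text \<open>The closed ball of radius \<open>R\<close> about 0 in the continuous maps from [0, b] to
  \<open>RFc\<close>; along its members \<open>f\<close> takes values in \<open>K\<close>.\<close>

definition admissible :: "(real \<Rightarrow> fuzzy) \<Rightarrow> bool" where
  "admissible v \<longleftrightarrow> continuous_on {0..b} v \<and> (\<forall>t\<in>{0..b}. v t \<in> RFc \<and> dist (v t) 0 \<le> R)"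

text \<open>Only the state is delayed, so \<open>f\<close> is still evaluated at positive times. Up
  to time \<open>d\<close> the state is frozen at \<open>v 0\<close>; for \<open>d = 0\<close> and
  \<open>s > 0\<close> the original integrand returns, so lemmas for \<open>0 \<le> d\<close> also
  cover the limit.\<close>

definition delayed :: "real \<Rightarrow> (real \<Rightarrow> fuzzy) \<Rightarrow> real \<Rightarrow> fuzzy" where
  "delayed d v s = f (s, v (max 0 (s - d)))"

definition delay_op :: "real \<Rightarrow> (real \<Rightarrow> fuzzy) \<Rightarrow> real \<Rightarrow> fuzzy" where
  "delay_op d v t = u\<^sub>0 t + c *\<^sub>R frac_fuzzy q (delayed d v) t"

lemma fuzzy_frac_integrand_delayed:
  assumes v: "admissible v" and d: "0 \<le> d"
  shows "fuzzy_frac_integrand q b M K (delayed d v)"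
proof
  have s: "max 0 (s - d) \<in> {0..b}" if "s \<in> {0<..<b}" for s using that d by auto
  have "continuous_on {0<..<b} (\<lambda>s. v (max 0 (s - d)))"
  proof (rule continuous_on_compose2[where t = "{0..b}" and g = v])
    show "continuous_on {0..b} v" using v by (simp add: admissible_def)
    show "continuous_on {0<..<b} (\<lambda>s. max 0 (s - d))" by (intro continuous_intros)
  qed (use s in blast)
  note cont = this
  show "continuous_on {0<..<b} (delayed d v)"
    unfolding delayed_def[abs_def]
  proof (rule continuous_on_compose2[OF f(1)])
    show "continuous_on {0<..<b} (\<lambda>s. (s, v (max 0 (s - d))))"
      by (intro continuous_on_Pair continuous_on_id cont)
    show "(\<lambda>s. (s, v (max 0 (s - d)))) ` {0<..<b} \<subseteq> {0<..b} \<times> RFc"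
      using v s unfolding admissible_def by auto
  qed
  show "delayed d v s \<in> K" if "s \<in> {0<..<b}" for s
    using v s[OF that] that unfolding admissible_def delayed_def by (intro f(2)) auto
qed (use q M K in auto)

text \<open>The right-hand side depends neither on \<open>v\<close> nor on \<open>d\<close>, which
  is the equicontinuity in time.\<close>

lemma dist_delay_op_le:
  assumes v: "admissible v" and d: "0 \<le> d" and t: "t \<in> {0..b}" "t' \<in> {0..b}"
  shows "dist (delay_op d v t) (delay_op d v t') \<le> dist (u\<^sub>0 t) (u\<^sub>0 t') + c * M * 2 / q * (\<bar>t - t'\<bar> powr q)"
proof -
  interpret fuzzy_frac_integrand q b M K "delayed d v" by (intro fuzzy_frac_integrand_delayed v d)
  have "dist (delay_op d v t) (delay_op d v t') \<le>
      dist (u\<^sub>0 t) (u\<^sub>0 t') + c * dist (frac_fuzzy q (delayed d v) t) (frac_fuzzy q (delayed d v) t')"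
    unfolding delay_op_def using c by (intro dist_plus_scaleR_le) simp
  also have "\<dots> \<le> dist (u\<^sub>0 t) (u\<^sub>0 t') + c * M * 2 / q * (\<bar>t - t'\<bar> powr q)"
    using mult_left_mono[OF dist_frac_fuzzy_le[OF t], of c] c by simp
  finally show ?thesis .
qed

lemma dist_level_delay_op_le:
  assumes v: "admissible v" and d: "0 \<le> d" and t: "t \<in> {0..b}" and \<alpha>: "\<alpha> \<in> {0..1}" "\<beta> \<in> {0..1}"
    and e: "\<And>x. x \<in> K \<Longrightarrow> dist (level x \<alpha>) (level x \<beta>) \<le> e"
  shows "dist (level (delay_op d v t) \<alpha>) (level (delay_op d v t) \<beta>) \<le>
    dist (level (u\<^sub>0 t) \<alpha>) (level (u\<^sub>0 t) \<beta>) + c * (e * (t powr q / q))"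
proof -
  interpret fuzzy_frac_integrand q b M K "delayed d v" by (intro fuzzy_frac_integrand_delayed v d)
  let ?w = "frac_fuzzy q (delayed d v) t"
  have *: "\<bar>(x + c * y) - (x' + c * y')\<bar> \<le> dist (level (u\<^sub>0 t) \<alpha>) (level (u\<^sub>0 t) \<beta>) + c * dist (level ?w \<alpha>) (level ?w \<beta>)"
    if "\<bar>x - x'\<bar> \<le> dist (level (u\<^sub>0 t) \<alpha>) (level (u\<^sub>0 t) \<beta>)" "\<bar>y - y'\<bar> \<le> dist (level ?w \<alpha>) (level ?w \<beta>)"
    for x x' y y'
  proof -
    have "\<bar>(x + c * y) - (x' + c * y')\<bar> = \<bar>(x - x') + c * (y - y')\<bar>" by (simp add: algebra_simps)
    also have "\<dots> \<le> \<bar>x - x'\<bar> + c * \<bar>y - y'\<bar>" using c by (metis abs_mult abs_of_pos abs_triangle_ineq)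
    also have "\<dots> \<le> dist (level (u\<^sub>0 t) \<alpha>) (level (u\<^sub>0 t) \<beta>) + c * dist (level ?w \<alpha>) (level ?w \<beta>)"
      using that c by (intro add_mono mult_left_mono) auto
    finally show ?thesis .
  qed
  have "dist (level (delay_op d v t) \<alpha>) (level (delay_op d v t) \<beta>) \<le>
    dist (level (u\<^sub>0 t) \<alpha>) (level (u\<^sub>0 t) \<beta>) + c * dist (level ?w \<alpha>) (level ?w \<beta>)"
    unfolding dist_level[of "delay_op d v t"] unfolding delay_op_def
    using c \<alpha> by (simp only: level_endpoints_plus level_endpoints_scaleR less_imp_le max.bounded_iff)
      (intro conjI *; simp add: dist_level)
  also have "\<dots> \<le> dist (level (u\<^sub>0 t) \<alpha>) (level (u\<^sub>0 t) \<beta>) + c * (e * (t powr q / q))"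
    using mult_left_mono[OF dist_level_frac_fuzzy_le[OF t \<alpha> e], of c] c by simp
  finally show ?thesis .
qed

lemma admissible_delay_op:
  assumes v: "admissible v" and d: "0 \<le> d"
  shows "admissible (delay_op d v)"
  unfolding admissible_def
proof (intro conjI ballI)
  interpret fuzzy_frac_integrand q b M K "delayed d v" by (intro fuzzy_frac_integrand_delayed v d)
  show "continuous_on {0..b} (delay_op d v)"
    unfolding continuous_on_iff
  proof (intro ballI allI impI)
    fix t and e :: real assume t: "t \<in> {0..b}" and "0 < e"
    then obtain d\<^sub>1 where d\<^sub>1: "d\<^sub>1 > 0" "\<And>t'. t' \<in> {0..b} \<Longrightarrow> dist t' t < d\<^sub>1 \<Longrightarrow> dist (u\<^sub>0 t') (u\<^sub>0 t) < e / 2"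
      using u\<^sub>0(1) unfolding continuous_on_iff by (metis half_gt_zero)
    obtain d\<^sub>2 where d\<^sub>2: "d\<^sub>2 > 0" "\<And>h. \<bar>h\<bar> < d\<^sub>2 \<Longrightarrow> c * M * 2 / q * (\<bar>h\<bar> powr q) < e / 2"
      using small_powr[OF q(1), of "e / 2" "c * M * 2 / q"] \<open>0 < e\<close> by auto
    show "\<exists>d'>0. \<forall>t'\<in>{0..b}. dist t' t < d' \<longrightarrow> dist (delay_op d v t') (delay_op d v t) < e"
    proof (intro exI[of _ "min d\<^sub>1 d\<^sub>2"] conjI ballI impI)
      fix t' assume t': "t' \<in> {0..b}" "dist t' t < min d\<^sub>1 d\<^sub>2"
      then show "dist (delay_op d v t') (delay_op d v t) < e"
        using dist_delay_op_le[OF v d t'(1) t] d\<^sub>1(2)[of t'] d\<^sub>2(2)[of "t' - t"] by (simp add: dist_real_def)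
    qed (use d\<^sub>1 d\<^sub>2 in simp)
  qed
  fix t assume t: "t \<in> {0..b}"
  show "delay_op d v t \<in> RFc"
    unfolding delay_op_def using c by (intro plus_scaleR_in_RFc u\<^sub>0(2) frac_fuzzy_in_RFc t) simp
  have "dist (delay_op d v t) 0 \<le> dist (u\<^sub>0 t) 0 + c * dist (frac_fuzzy q (delayed d v) t) 0"
    using dist_plus_scaleR_le[of c "u\<^sub>0 t" "frac_fuzzy q (delayed d v) t" 0 0] c
    by (simp add: delay_op_def zero_plus_scaleR_zero)
  \<comment> \<open>Assumption \<open>R\<close> is formulated at the final time, where
    \<open>t powr q\<close> is largest.\<close>
  also have "c * dist (frac_fuzzy q (delayed d v) t) 0 \<le> c * (M * (b powr q / q))"
  proof -
    have "M * (t powr q / q) \<le> M * (b powr q / q)"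
      using M q t by (intro mult_left_mono divide_right_mono powr_mono2) auto
    then show ?thesis using dist_frac_fuzzy_zero_le[OF t] c by (intro mult_left_mono) auto
  qed
  finally show "dist (delay_op d v t) 0 \<le> R" using R[OF t] by simp
qed

lemma admissible_initial: "admissible u\<^sub>0"
proof -
  have "0 \<le> c * (M * (b powr q / q))" using c M q by simp
  then show ?thesis unfolding admissible_def using u\<^sub>0 R by force
qed

lemma admissible_funpow: "0 \<le> d \<Longrightarrow> admissible ((delay_op d ^^ n) u\<^sub>0)"
  by (induction n) (auto intro: admissible_initial admissible_delay_op)

lemma delay_op_at_0: "admissible v \<Longrightarrow> 0 \<le> d \<Longrightarrow> delay_op d v 0 = u\<^sub>0 0"
  using fuzzy_frac_integrand.frac_fuzzy_0[OF fuzzy_frac_integrand_delayed] b c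
  by (simp add: delay_op_def plus_scaleR_zero)

text \<open>The value of \<open>delay_op d v\<close> at \<open>t\<close> only depends on \<open>v\<close> up to time \<open>t - d\<close>, so that each
  iteration settles the solution of the delayed equation on a further interval of length \<open>d\<close>.\<close>

lemma funpow_delay_op_stable:
  assumes d: "0 < d" and t: "t \<in> {0..b}" "t \<le> real n * d"
  shows "(delay_op d ^^ Suc n) u\<^sub>0 t = (delay_op d ^^ n) u\<^sub>0 t"
  using t
proof (induction n arbitrary: t)
  case 0
  then show ?case using delay_op_at_0[OF admissible_initial] d by simp
next
  case (Suc n)
  have "frac_fuzzy q (delayed d ((delay_op d ^^ Suc n) u\<^sub>0)) t = frac_fuzzy q (delayed d ((delay_op d ^^ n) u\<^sub>0)) t"
  proof (rule frac_fuzzy_cong)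
    fix s assume "s \<in> {0<..<t}"
    then have "max 0 (s - d) \<in> {0..b}" "max 0 (s - d) \<le> real n * d"
      using Suc.prems d by (auto simp: algebra_simps)
    from Suc.IH[OF this]
    show "delayed d ((delay_op d ^^ Suc n) u\<^sub>0) s = delayed d ((delay_op d ^^ n) u\<^sub>0) s"
      by (simp add: delayed_def)
  qed
  then show ?case by (simp add: delay_op_def[of _ _ t])
qed

text \<open>An iterate with \<open>real n * d > b\<close> is settled on all of [0, b], hence fixed
  there by the operator.\<close>

lemma exists_delayed_solution:
  assumes "0 < d"
  obtains v where "admissible v" "\<And>t. t \<in> {0..b} \<Longrightarrow> delay_op d v t = v t"
proof -
  obtain n where n: "b < real n * d" using reals_Archimedean3[OF assms] by blast
  have "delay_op d ((delay_op d ^^ n) u\<^sub>0) t = (delay_op d ^^ n) u\<^sub>0 t" if "t \<in> {0..b}" for t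
    using funpow_delay_op_stable[OF assms that, of n] that n by simp
  with admissible_funpow[of d n] assms show thesis using that by simp
qed

text \<open>The comparison passes through time \<open>t\<close> and level \<beta>. The change of
  time is controlled by the metric of \<open>fuzzy\<close>, a supremum over all levels; the change
  of level happens at the fixed time \<open>t\<close>, so there only the continuity of the levels of
  \<open>u\<^sub>0 t\<close> enters. The radius is chosen before \<open>d\<close> and
  \<open>v\<close>.\<close>

lemma delay_op_equicontinuous:
  assumes p: "p \<in> {0..b} \<times> {0..1}" and "0 < e"
  obtains r where "0 < r" "\<And>d v p'. 0 \<le> d \<Longrightarrow> admissible v \<Longrightarrow> p' \<in> {0..b} \<times> {0..1} \<Longrightarrow> dist p p' < r \<Longrightarrow>
    dist (level (delay_op d v (fst p)) (snd p)) (level (delay_op d v (fst p')) (snd p')) < e"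
proof -
  obtain t \<alpha> where p_eq: "p = (t, \<alpha>)" and t: "t \<in> {0..b}" and \<alpha>: "\<alpha> \<in> {0..1}" using p by auto
  obtain d\<^sub>1 where d\<^sub>1: "d\<^sub>1 > 0" "\<And>t'. t' \<in> {0..b} \<Longrightarrow> dist t' t < d\<^sub>1 \<Longrightarrow> dist (u\<^sub>0 t') (u\<^sub>0 t) < e / 4"
    using u\<^sub>0(1) t \<open>0 < e\<close> unfolding continuous_on_iff by (metis zero_less_divide_iff zero_less_numeral)
  obtain d\<^sub>2 where d\<^sub>2: "d\<^sub>2 > 0" "\<And>h. \<bar>h\<bar> < d\<^sub>2 \<Longrightarrow> c * M * 2 / q * (\<bar>h\<bar> powr q) < e / 4"
    using small_powr[OF q(1), of "e / 4" "c * M * 2 / q"] \<open>0 < e\<close> by auto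
  have "continuous_on {0..1} (level (u\<^sub>0 t))" using u\<^sub>0(2)[OF t] by (simp add: RFc_def)
  then obtain d\<^sub>3 where d\<^sub>3: "d\<^sub>3 > 0"
    "\<And>\<beta>. \<beta> \<in> {0..1} \<Longrightarrow> dist \<beta> \<alpha> < d\<^sub>3 \<Longrightarrow> dist (level (u\<^sub>0 t) \<beta>) (level (u\<^sub>0 t) \<alpha>) < e / 4"
    using \<alpha> \<open>0 < e\<close> unfolding continuous_on_iff by (metis zero_less_divide_iff zero_less_numeral)
  \<comment> \<open>The summand 1 keeps \<open>C\<close> positive at \<open>t = 0\<close>; dividing
    \<open>e / 4\<close> by \<open>C\<close> compensates the factor
    \<open>c * (t powr q / q)\<close> produced by the integral.\<close>
  define C where "C = c * (t powr q / q) + 1"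
  have "0 \<le> c * (t powr q / q)" using c q by simp
  then have C: "C > 0" "c * (t powr q / q) \<le> C" by (simp_all add: C_def)
  obtain d\<^sub>4 where d\<^sub>4: "d\<^sub>4 > 0" "\<And>x \<alpha> \<beta>. x \<in> K \<Longrightarrow> \<alpha> \<in> {0..1} \<Longrightarrow> \<beta> \<in> {0..1} \<Longrightarrow> \<bar>\<alpha> - \<beta>\<bar> < d\<^sub>4 \<Longrightarrow>
      dist (level x \<alpha>) (level x \<beta>) < e / 4 / C"
    using compact_RFc_equicontinuous[OF K(1,2), of "e / 4 / C"] C \<open>0 < e\<close> by auto
  show thesis
  proof (rule that[of "min (min d\<^sub>1 d\<^sub>2) (min d\<^sub>3 d\<^sub>4)"])
    fix d :: real and v p' assume d: "0 \<le> d" and v: "admissible v" and p': "p' \<in> {0..b} \<times> {0..1}"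
      and close: "dist p p' < min (min d\<^sub>1 d\<^sub>2) (min d\<^sub>3 d\<^sub>4)"
    obtain t' \<beta> where p'_eq: "p' = (t', \<beta>)" and t': "t' \<in> {0..b}" and \<beta>: "\<beta> \<in> {0..1}" using p' by auto
    have tt: "\<bar>t - t'\<bar> < d\<^sub>1" "\<bar>t - t'\<bar> < d\<^sub>2" and \<alpha>\<beta>: "\<bar>\<alpha> - \<beta>\<bar> < d\<^sub>3" "\<bar>\<alpha> - \<beta>\<bar> < d\<^sub>4"
      using close dist_fst_le[of p p'] dist_snd_le[of p p'] by (auto simp: p_eq p'_eq dist_real_def)
    have "dist (u\<^sub>0 t) (u\<^sub>0 t') < e / 4"
      using d\<^sub>1(2)[OF t'] tt(1) by (simp only: dist_real_def dist_commute[of "u\<^sub>0 t"] abs_minus_commute[of t])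
    then have "dist (delay_op d v t) (delay_op d v t') < e / 4 + e / 4"
      using dist_delay_op_le[OF v d t t'] d\<^sub>2(2)[OF tt(2)] by linarith
    moreover have "dist (level (delay_op d v t) \<alpha>) (level (delay_op d v t) \<beta>) < e / 4 + e / 4"
    proof -
      have "c * (e / 4 / C * (t powr q / q)) = (c * (t powr q / q)) / C * (e / 4)" by (simp add: mult_ac)
      also have "\<dots> \<le> 1 * (e / 4)"
      proof (rule mult_right_mono)
        show "c * (t powr q / q) / C \<le> 1" using C by (simp only: divide_le_eq_1_pos)
      qed (use \<open>0 < e\<close> in simp)
      finally have "c * (e / 4 / C * (t powr q / q)) \<le> e / 4" by simp
      moreover have "dist (level (u\<^sub>0 t) \<alpha>) (level (u\<^sub>0 t) \<beta>) < e / 4"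
        using d\<^sub>3(2)[OF \<beta>] \<alpha>\<beta>(1)
        by (simp only: dist_real_def dist_commute[of "level (u\<^sub>0 t) \<alpha>"] abs_minus_commute[of \<alpha>])
      ultimately show ?thesis
        using dist_level_delay_op_le[OF v d t \<alpha> \<beta> less_imp_le[OF d\<^sub>4(2)[OF _ \<alpha> \<beta> \<alpha>\<beta>(2)]]] by linarith
    qed
    ultimately show "dist (level (delay_op d v (fst p)) (snd p)) (level (delay_op d v (fst p')) (snd p')) < e"
      using dist_level_triangle[OF \<beta>, of "delay_op d v t" \<alpha> "delay_op d v t'"] by (simp add: p_eq p'_eq)
  qed (use d\<^sub>1 d\<^sub>2 d\<^sub>3 d\<^sub>4 in auto)
qed

text \<open>A solution of the delayed equation equals its own image under \<open>delay_op\<close>,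
  so equicontinuity of the images is equicontinuity of the sequence \<open>v\<close>. Arzela-Ascoli
  is applied to the plane-valued maps \<open>?E n\<close>; uniformity in the level turns its
  conclusion into convergence in the metric of \<open>fuzzy\<close>.\<close>

lemma exists_delayed_limit:
  fixes v :: "nat \<Rightarrow> real \<Rightarrow> fuzzy"
  assumes d: "\<And>n. 0 \<le> d n" and v: "\<And>n. admissible (v n)"
    and fixpoint: "\<And>n t. t \<in> {0..b} \<Longrightarrow> delay_op (d n) (v n) t = v n t"
  obtains u k where "strict_mono (k :: nat \<Rightarrow> nat)" "admissible u"
    "uniform_limit {0..b} (\<lambda>n. v (k n)) u sequentially"
proof -
  let ?S = "{0..b} \<times> {0..1::real}"
  let ?E = "\<lambda>n p. (level_lo (v n (fst p)) (snd p), level_hi (v n (fst p)) (snd p))"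
  have vR: "dist (v n t) 0 \<le> R" "v n t \<in> RFc" if "t \<in> {0..b}" for n t
    using v that by (auto simp: admissible_def)
  have compact: "compact ?S" by (intro compact_Times compact_Icc)
  have bound: "norm (?E n p) \<le> 2 * R" if "p \<in> ?S" for n p
    using that by (intro norm_endpoints_le order_trans[OF _ vR(1)[of "fst p" n]] abs_level_endpoints_le_dist) auto
  have equi: "\<exists>r>0. \<forall>n p'. p' \<in> ?S \<and> norm (p - p') < r \<longrightarrow> norm (?E n p - ?E n p') < e"
    if p: "p \<in> ?S" and "0 < e" for p e
  proof -
    \<comment> \<open>Half of \<open>e\<close> is requested because \<open>norm_endpoints_le\<close>
      bounds the norm of a pair by twice a bound on its entries.\<close>
    obtain r where r: "0 < r" "\<And>d v p'. 0 \<le> d \<Longrightarrow> admissible v \<Longrightarrow> p' \<in> ?S \<Longrightarrow> dist p p' < r \<Longrightarrow>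
        dist (level (delay_op d v (fst p)) (snd p)) (level (delay_op d v (fst p')) (snd p')) < e / 2"
      using delay_op_equicontinuous[OF p, of "e / 2"] \<open>0 < e\<close> by auto
    have "norm (?E n p - ?E n p') < e" if p': "p' \<in> ?S" "norm (p - p') < r" for n p'
    proof -
      let ?D = "dist (level (v n (fst p)) (snd p)) (level (v n (fst p')) (snd p'))"
      have "?D < e / 2"
        using r(2)[OF d v, of p' n n] p' p fixpoint by (auto simp: dist_norm mem_Times_iff)
      moreover have "norm (?E n p - ?E n p') \<le> 2 * ?D"
        unfolding diff_Pair by (intro norm_endpoints_le) (simp_all add: dist_level)
      ultimately show ?thesis by simp
    qed
    with r(1) show ?thesis by blast
  qed
  obtain g k where g: "continuous_on ?S g" and k: "strict_mono (k :: nat \<Rightarrow> nat)"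
    and lim: "\<And>e. 0 < e \<Longrightarrow> \<exists>N. \<forall>n p. N \<le> n \<and> p \<in> ?S \<longrightarrow> norm (?E (k n) p - g p) < e"
    using Arzela_Ascoli[OF compact bound equi] by blast
  have close: "\<exists>N. \<forall>n\<ge>N. \<forall>t\<in>{0..b}. \<forall>\<alpha>\<in>{0..1}.
      \<bar>level_lo (v (k n) t) \<alpha> - fst (g (t, \<alpha>))\<bar> < e \<and> \<bar>level_hi (v (k n) t) \<alpha> - snd (g (t, \<alpha>))\<bar> < e"
    if "0 < e" for e
  proof -
    obtain N where N: "\<And>n p. N \<le> n \<Longrightarrow> p \<in> ?S \<Longrightarrow> norm (?E (k n) p - g p) < e"
      using lim[OF \<open>0 < e\<close>] by blast
    show ?thesis
    proof (intro exI[of _ N] allI impI ballI)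
      fix n t \<alpha> assume "N \<le> n" "t \<in> {0..b}" "\<alpha> \<in> {0..1::real}"
      then have "norm (?E (k n) (t, \<alpha>) - g (t, \<alpha>)) < e" by (intro N) auto
      then show "\<bar>level_lo (v (k n) t) \<alpha> - fst (g (t, \<alpha>))\<bar> < e \<and> \<bar>level_hi (v (k n) t) \<alpha> - snd (g (t, \<alpha>))\<bar> < e"
        using dist_fst_le[of "?E (k n) (t, \<alpha>)" "g (t, \<alpha>)"] dist_snd_le[of "?E (k n) (t, \<alpha>)" "g (t, \<alpha>)"]
        by (simp add: dist_real_def dist_norm[of "(_, _)"])
    qed
  qed
  have lim_lo: "(\<lambda>n. level_lo (v (k n) t) \<alpha>) \<longlonglongrightarrow> fst (g (t, \<alpha>))"
    and lim_hi: "(\<lambda>n. level_hi (v (k n) t) \<alpha>) \<longlonglongrightarrow> snd (g (t, \<alpha>))"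
    if "t \<in> {0..b}" "\<alpha> \<in> {0..1}" for t \<alpha>
    unfolding lim_sequentially dist_real_def using close that by meson+
  \<comment> \<open>At fixed \<open>t\<close> the limit is continuous in the level, and monotonicity
    and order of the endpoints survive pointwise limits, so \<open>g\<close> at time
    \<open>t\<close> consists of the endpoints of a fuzzy number.\<close>
  have "\<exists>w. w \<in> RFc \<and> (\<forall>\<alpha>\<in>{0..1}. level_lo w \<alpha> = fst (g (t, \<alpha>)) \<and> level_hi w \<alpha> = snd (g (t, \<alpha>)))"
    if t: "t \<in> {0..b}" for t
  proof -
    have gt: "continuous_on {0..1} (\<lambda>\<alpha>. g (t, \<alpha>))"
      using t by (intro continuous_on_compose2[OF g] continuous_intros) auto
    obtain w where "w \<in> RFc" "\<And>\<alpha>. \<alpha> \<in> {0..1} \<Longrightarrow> level_lo w \<alpha> = fst (g (t, \<alpha>))"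
      "\<And>\<alpha>. \<alpha> \<in> {0..1} \<Longrightarrow> level_hi w \<alpha> = snd (g (t, \<alpha>))"
    proof (rule exists_RFc_with_endpoints)
      show "continuous_on {0..1} (\<lambda>\<alpha>. fst (g (t, \<alpha>)))" "continuous_on {0..1} (\<lambda>\<alpha>. snd (g (t, \<alpha>)))"
        using gt by (auto intro: continuous_intros)
      fix \<alpha> \<beta> :: real assume \<alpha>\<beta>: "0 \<le> \<alpha>" "\<alpha> \<le> \<beta>" "\<beta> \<le> 1"
      then have "\<alpha> \<in> {0..1}" "\<beta> \<in> {0..1}" by auto
      then show "fst (g (t, \<alpha>)) \<le> fst (g (t, \<beta>))" "snd (g (t, \<beta>)) \<le> snd (g (t, \<alpha>))"
        using level_endpoints_mono[OF \<alpha>\<beta>]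
        by (intro LIMSEQ_le[OF lim_lo lim_lo] LIMSEQ_le[OF lim_hi lim_hi]; use t in blast)+
    next
      show "fst (g (t, 1)) \<le> snd (g (t, 1))"
        by (intro LIMSEQ_le[OF lim_lo lim_hi] exI[of _ 0] allI impI level_lo_le_hi t) simp_all
    qed auto
    then show ?thesis by auto
  qed
  then obtain u where u: "\<And>t. t \<in> {0..b} \<Longrightarrow> u t \<in> RFc"
    "\<And>t \<alpha>. t \<in> {0..b} \<Longrightarrow> \<alpha> \<in> {0..1} \<Longrightarrow> level_lo (u t) \<alpha> = fst (g (t, \<alpha>)) \<and> level_hi (u t) \<alpha> = snd (g (t, \<alpha>))"
    by metis
  have unif: "uniform_limit {0..b} (\<lambda>n. v (k n)) u sequentially"
    unfolding uniform_limit_iff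
  proof (intro allI impI)
    fix e :: real assume "0 < e"
    then obtain N where N: "\<And>n t \<alpha>. N \<le> n \<Longrightarrow> t \<in> {0..b} \<Longrightarrow> \<alpha> \<in> {0..1} \<Longrightarrow>
        \<bar>level_lo (v (k n) t) \<alpha> - fst (g (t, \<alpha>))\<bar> < e / 2 \<and> \<bar>level_hi (v (k n) t) \<alpha> - snd (g (t, \<alpha>))\<bar> < e / 2"
      using close[OF half_gt_zero] by metis
    have "dist (v (k n) t) (u t) \<le> e / 2" if "N \<le> n" "t \<in> {0..b}" for n t
      using N[OF that] u(2)[OF that(2)] by (intro dist_fuzzy_le) (metis less_imp_le)+
    then have "\<forall>t\<in>{0..b}. dist (v (k n) t) (u t) < e" if "N \<le> n" for n
      using that \<open>0 < e\<close> by (fastforce intro: le_less_trans)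
    then show "\<forall>\<^sub>F n in sequentially. \<forall>t\<in>{0..b}. dist (v (k n) t) (u t) < e"
      unfolding eventually_sequentially by blast
  qed
  have "admissible u"
    unfolding admissible_def
  proof (intro conjI ballI u(1))
    show "continuous_on {0..b} u"
      using v by (intro uniform_limit_theorem[OF _ unif]) (auto simp: admissible_def)
    fix t assume t: "t \<in> {0..b}"
    have "(\<lambda>n. dist (v (k n) t) 0) \<longlonglongrightarrow> dist (u t) 0"
      by (intro tendsto_dist tendsto_uniform_limitI[OF unif t] tendsto_const)
    then show "dist (u t) 0 \<le> R" by (rule LIMSEQ_le_const2) (use vR(1)[OF t] in blast)
  qed
  with k unif show thesis using that by blast
qed

text \<open>The evaluation point moves with \<open>n\<close>: uniform convergence compares
  \<open>v n\<close> with \<open>u\<close> at the moving point, and continuity of \<open>u\<close>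
  then brings that point to \<open>s\<close>. Continuity of \<open>f\<close> at
  \<open>(s, u s)\<close> finishes.\<close>

lemma delayed_tendsto:
  assumes v: "\<And>n. admissible (v n)" and u: "admissible u" and d: "\<And>n. 0 \<le> d n" "d \<longlonglongrightarrow> 0"
    and unif: "uniform_limit {0..b} v u sequentially" and s: "s \<in> {0<..<b}"
  shows "(\<lambda>n. delayed (d n) (v n) s) \<longlonglongrightarrow> delayed 0 u s"
proof -
  let ?s = "\<lambda>n. max 0 (s - d n)"
  have s': "?s n \<in> {0..b}" for n using s d(1)[of n] by auto
  have "?s \<longlonglongrightarrow> max 0 (s - 0)" by (intro tendsto_intros d)
  then have "(\<lambda>n. u (?s n)) \<longlonglongrightarrow> u s"
    using u s s' unfolding admissible_def by (intro continuous_on_tendsto_compose[of "{0..b}" u]) auto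
  then have "(\<lambda>n. dist (u (?s n)) (u s)) \<longlonglongrightarrow> 0" by (simp flip: tendsto_dist_iff)
  moreover have "(\<lambda>n. dist (v n (?s n)) (u (?s n))) \<longlonglongrightarrow> 0"
  proof (rule tendstoI)
    fix e :: real assume "0 < e"
    with unif have "\<forall>\<^sub>F n in sequentially. \<forall>t\<in>{0..b}. dist (v n t) (u t) < e" by (simp add: uniform_limit_iff)
    then show "\<forall>\<^sub>F n in sequentially. dist (dist (v n (?s n)) (u (?s n))) 0 < e"
      by eventually_elim (use s' in simp)
  qed
  ultimately have "(\<lambda>n. dist (v n (?s n)) (u (?s n)) + dist (u (?s n)) (u s)) \<longlonglongrightarrow> 0 + 0"
    by (rule tendsto_add[rotated])
  then have "(\<lambda>n. dist (v n (?s n)) (u s)) \<longlonglongrightarrow> 0"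
    using Lim_null_comparison[of "\<lambda>n. dist (v n (?s n)) (u s)" "\<lambda>n. dist (v n (?s n)) (u (?s n)) + dist (u (?s n)) (u s)"]
    by (simp add: dist_triangle)
  then have "(\<lambda>n. v n (?s n)) \<longlonglongrightarrow> u s" by (simp only: tendsto_dist_iff[of _ "u s"])
  then have "(\<lambda>n. (s, v n (?s n))) \<longlonglongrightarrow> (s, u s)" by (intro tendsto_Pair tendsto_const)
  moreover have "(s, u s) \<in> {0<..b} \<times> RFc" using u s by (auto simp: admissible_def)
  moreover have "\<forall>\<^sub>F n in sequentially. (s, v n (?s n)) \<in> {0<..b} \<times> RFc"
    using v s s' by (auto simp: admissible_def)
  ultimately have "(\<lambda>n. f (s, v n (?s n))) \<longlonglongrightarrow> f (s, u s)"
    by (rule continuous_on_tendsto_compose[OF f(1)])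
  then show ?thesis using s by (simp add: delayed_def)
qed

text \<open>The delayed equations are followed endpoint by endpoint along the subsequence: the left
  side converges by uniform convergence, the right side by dominated convergence, and real limits
  are unique.\<close>

lemma exists_solution:
  obtains u where "admissible u"
    "\<And>t. t \<in> {0..b} \<Longrightarrow> fuzzy_integrable {0<..<t} (\<lambda>s. (t - s) powr (q - 1) *\<^sub>R f (s, u s))"
    "\<And>t. t \<in> {0..b} \<Longrightarrow> u t = u\<^sub>0 t + c *\<^sub>R fuzzy_integral {0<..<t} (\<lambda>s. (t - s) powr (q - 1) *\<^sub>R f (s, u s))"
proof -
  define d :: "nat \<Rightarrow> real" where "d n = inverse (real (Suc n))" for n
  have d: "0 < d n" for n by (simp add: d_def)
  have "\<exists>v. admissible v \<and> (\<forall>t\<in>{0..b}. delay_op (d n) v t = v t)" for n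
    using exists_delayed_solution[OF d] by metis
  then obtain v where v: "\<And>n. admissible (v n)" "\<And>n t. t \<in> {0..b} \<Longrightarrow> delay_op (d n) (v n) t = v n t"
    by metis
  obtain u k where k: "strict_mono (k :: nat \<Rightarrow> nat)" and u: "admissible u"
    and unif: "uniform_limit {0..b} (\<lambda>n. v (k n)) u sequentially"
    by (rule exists_delayed_limit[OF less_imp_le[OF d] v])
  have dk: "0 \<le> d (k n)" "(\<lambda>n. d (k n)) \<longlonglongrightarrow> 0" for n
    using LIMSEQ_subseq_LIMSEQ[OF LIMSEQ_inverse_real_of_nat k] d[of "k n"] by (simp_all add: d_def o_def)
  let ?F = "\<lambda>n. delayed (d (k n)) (v (k n))"
  interpret lim: fuzzy_frac_integrand q b M K "delayed 0 u"
    by (intro fuzzy_frac_integrand_delayed u) simp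
  interpret approx: fuzzy_frac_integrand q b M K "?F n" for n
    by (intro fuzzy_frac_integrand_delayed v dk)
  \<comment> \<open>The truncation \<open>max 0 s\<close> is harmless because the interval of
    integration contains positive times only.\<close>
  have undelayed: "delayed 0 u s = f (s, u s)" if "s \<in> {0<..<t}" for s t
    using that by (simp add: delayed_def)
  have eq: "u t = u\<^sub>0 t + c *\<^sub>R frac_fuzzy q (delayed 0 u) t" if t: "t \<in> {0..b}" for t
  proof (rule fuzzy_eq_endpointsI)
    fix \<alpha> :: real assume \<alpha>: "\<alpha> \<in> {0..1}"
    have t': "0 \<le> t" "t \<le> b" using t by auto
    have lim_v: "(\<lambda>n. v (k n) t) \<longlonglongrightarrow> u t" by (rule tendsto_uniform_limitI[OF unif t])
    have v_eq: "v (k n) t = u\<^sub>0 t + c *\<^sub>R frac_fuzzy q (?F n) t" for n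
      using v(2)[OF t, of "k n"] by (simp add: delay_op_def)
    have lim_F: "(\<lambda>n. ?F n s) \<longlonglongrightarrow> delayed 0 u s" if "s \<in> {0<..<b}" for s
      by (rule delayed_tendsto[OF v(1) u dk(1) dk(2) unif that])
    have "(\<lambda>n. level_lo (u\<^sub>0 t) \<alpha> + c * frac_int q (\<lambda>s. level_lo (?F n s) \<alpha>) t)
        \<longlonglongrightarrow> level_lo (u\<^sub>0 t) \<alpha> + c * frac_int q (\<lambda>s. level_lo (delayed 0 u s) \<alpha>) t"
      by (intro tendsto_intros frac_int_tendsto[OF q(1) t' approx.continuous_lo[OF \<alpha>] approx.bounded_lo[OF \<alpha>]
          lim.continuous_lo[OF \<alpha>] lim.bounded_lo[OF \<alpha>]] tendsto_level_endpoints(1)[OF lim_F \<alpha>])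
    moreover have "(\<lambda>n. level_lo (u\<^sub>0 t) \<alpha> + c * frac_int q (\<lambda>s. level_lo (?F n s) \<alpha>) t) \<longlonglongrightarrow> level_lo (u t) \<alpha>"
      using tendsto_level_endpoints(1)[OF lim_v \<alpha>] c \<alpha>
      by (simp add: v_eq level_endpoints_plus level_endpoints_scaleR approx.level_lo_frac_fuzzy[OF t])
    ultimately have "level_lo (u t) \<alpha> = level_lo (u\<^sub>0 t) \<alpha> + c * frac_int q (\<lambda>s. level_lo (delayed 0 u s) \<alpha>) t"
      by (rule LIMSEQ_unique[rotated])
    then show "level_lo (u t) \<alpha> = level_lo (u\<^sub>0 t + c *\<^sub>R frac_fuzzy q (delayed 0 u) t) \<alpha>"
      using c \<alpha> by (simp add: level_endpoints_plus level_endpoints_scaleR lim.level_lo_frac_fuzzy[OF t])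
    have "(\<lambda>n. level_hi (u\<^sub>0 t) \<alpha> + c * frac_int q (\<lambda>s. level_hi (?F n s) \<alpha>) t)
        \<longlonglongrightarrow> level_hi (u\<^sub>0 t) \<alpha> + c * frac_int q (\<lambda>s. level_hi (delayed 0 u s) \<alpha>) t"
      by (intro tendsto_intros frac_int_tendsto[OF q(1) t' approx.continuous_hi[OF \<alpha>] approx.bounded_hi[OF \<alpha>]
          lim.continuous_hi[OF \<alpha>] lim.bounded_hi[OF \<alpha>]] tendsto_level_endpoints(2)[OF lim_F \<alpha>])
    moreover have "(\<lambda>n. level_hi (u\<^sub>0 t) \<alpha> + c * frac_int q (\<lambda>s. level_hi (?F n s) \<alpha>) t) \<longlonglongrightarrow> level_hi (u t) \<alpha>"
      using tendsto_level_endpoints(2)[OF lim_v \<alpha>] c \<alpha>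
      by (simp add: v_eq level_endpoints_plus level_endpoints_scaleR approx.level_hi_frac_fuzzy[OF t])
    ultimately have "level_hi (u t) \<alpha> = level_hi (u\<^sub>0 t) \<alpha> + c * frac_int q (\<lambda>s. level_hi (delayed 0 u s) \<alpha>) t"
      by (rule LIMSEQ_unique[rotated])
    then show "level_hi (u t) \<alpha> = level_hi (u\<^sub>0 t + c *\<^sub>R frac_fuzzy q (delayed 0 u) t) \<alpha>"
      using c \<alpha> by (simp add: level_endpoints_plus level_endpoints_scaleR lim.level_hi_frac_fuzzy[OF t])
  qed
  \<comment> \<open>The locale looks at the integrand on (0, b) only, where
    \<open>delayed 0 u\<close> and the undelayed integrand agree.\<close>
  interpret sol: fuzzy_frac_integrand q b M K "\<lambda>s. f (s, u s)"
    using lim.fuzzy_frac_integrand_axioms undelayed[of _ b]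
    by (simp add: fuzzy_frac_integrand_def cong: continuous_on_cong_simp)
  show thesis
  proof
    show "u t = u\<^sub>0 t + c *\<^sub>R fuzzy_integral {0<..<t} (\<lambda>s. (t - s) powr (q - 1) *\<^sub>R f (s, u s))"
      if "t \<in> {0..b}" for t
    proof -
      have "frac_fuzzy q (delayed 0 u) t = frac_fuzzy q (\<lambda>s. f (s, u s)) t" by (intro frac_fuzzy_cong undelayed)
      then show ?thesis using eq[OF that] by (simp only: frac_fuzzy_def)
    qed
  qed (use u sol.fuzzy_integrable_frac in auto)
qed

end

section \<open>Choice of the compact set \<open>K\<close> and the growth estimate behind
  \<eta>\<close>

theorem theorem4p2:
  fixes a q N R M \<eta> :: real
    and u\<^sub>0 :: "real \<Rightarrow> fuzzy"
    and f :: "real \<times> fuzzy \<Rightarrow> fuzzy"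
    and G :: "(real \<times> fuzzy) set"
  assumes "0 < a" and "0 < q" and "q < 1"
    and "continuous_on {0..a} u\<^sub>0" and "u\<^sub>0 ` {0..a} \<subseteq> RFc"
    and "f ` ({0<..a} \<times> RFc) \<subseteq> RFc"
    and "continuous_on ({0<..a} \<times> RFc) f"
    and "compact_map_on ({0<..a} \<times> RFc) RFc f"
    and "N = (SUP t\<in>{0..a}. dist (u\<^sub>0 t) 0)"
    and "R > N"
    and "G = {(t, x). t \<in> {0<..a} \<and> x \<in> RFc \<and> dist x 0 \<le> R}"
    and "M = (SUP p\<in>G. dist (f p) 0)"
    and "\<eta> = (if M = 0 then a else min a (((R - N) * Gamma (q + 1) / M) powr (1 / q)))"
  shows "\<exists>u. continuous_on {0..\<eta>} u \<and> u ` {0..\<eta>} \<subseteq> RFc \<and>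
    (\<forall>t\<in>{0..\<eta>}.
       fuzzy_integrable {0<..<t} (\<lambda>s. (t - s) powr (q - 1) *\<^sub>R f (s, u s)) \<and>
       u t = u\<^sub>0 t + (1 / Gamma q) *\<^sub>R
         fuzzy_integral {0<..<t} (\<lambda>s. (t - s) powr (q - 1) *\<^sub>R f (s, u s)))"
proof -
  have "bounded (u\<^sub>0 ` {0..a})"
    using assms(4) by (intro compact_imp_bounded compact_continuous_image) auto
  then obtain e where "\<And>t. t \<in> {0..a} \<Longrightarrow> dist (u\<^sub>0 t) 0 \<le> e"
    unfolding bounded_any_center[where a = 0] by (metis dist_commute imageI)
  then have "bdd_above ((\<lambda>t. dist (u\<^sub>0 t) 0) ` {0..a})" by (rule bdd_aboveI2)
  then have N: "dist (u\<^sub>0 t) 0 \<le> N" if "t \<in> {0..a}" for t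
    unfolding assms(9) using that by (intro cSUP_upper)
  have "0 \<le> N" using order_trans[OF zero_le_dist N[of 0]] assms(1) by simp
  have G_sub: "G \<subseteq> {0<..a} \<times> RFc" unfolding assms(11) by auto
  have "bounded G"
  proof (rule bounded_subset[OF bounded_Times])
    show "bounded {0..a}" by simp
    show "bounded (cball (0 :: fuzzy) R)" by simp
    show "G \<subseteq> {0..a} \<times> cball 0 R" unfolding assms(11) by (auto simp: dist_commute)
  qed
  \<comment> \<open>Relative compactness is meant in the subspace \<open>RFc\<close>, so the closure
    is intersected with it.\<close>
  define K where "K = RFc \<inter> closure (f ` G)"
  have "compact K"
    using assms(8) G_sub \<open>bounded G\<close> unfolding compact_map_on_def relatively_compact_in_def K_def by blast
  have fG: "f p \<in> K" if "p \<in> G" for p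
    using that G_sub assms(6) closure_subset[of "f ` G"] unfolding K_def by blast
  obtain B where B: "\<And>x. x \<in> K \<Longrightarrow> dist 0 x \<le> B"
    using compact_imp_bounded[OF \<open>compact K\<close>] unfolding bounded_any_center[where a = 0] by blast
  \<comment> \<open>Boundedness of \<open>K\<close> makes the supremum \<open>M\<close> a genuine
    upper bound.\<close>
  have M: "dist (f p) 0 \<le> M" if "p \<in> G" for p
    unfolding assms(12) using that B[OF fG]
    by (intro cSUP_upper bdd_aboveI2[of _ _ B]) (simp_all add: dist_commute)
  have "(a, 0) \<in> G" using assms(1,10) \<open>0 \<le> N\<close> zero_in_RFc by (simp add: assms(11))
  then have "0 \<le> M" using M zero_le_dist order_trans by blast
  \<comment> \<open>A closed ball contains the closure of each of its subsets, so the bound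
    \<open>M\<close> extends from the image of \<open>G\<close> to \<open>K\<close>.\<close>
  have KM: "dist x 0 \<le> M" if "x \<in> K" for x
  proof -
    have "f ` G \<subseteq> cball 0 M" using M by (auto simp: dist_commute)
    then have "closure (f ` G) \<subseteq> cball 0 M" by (rule closure_minimal) simp
    then show ?thesis using that by (auto simp: K_def dist_commute)
  qed
  have Gq: "0 < Gamma q" "Gamma (q + 1) = q * Gamma q"
    using assms(2) by (auto intro!: Gamma_real_pos Gamma_plus1 dest: nonpos_Ints_nonpos)
  have \<eta>: "0 \<le> \<eta>" "\<eta> \<le> a" using assms(1) by (auto simp: assms(13))
  \<comment> \<open>The origin of \<eta>: inserting \<open>Gamma (q + 1) = q * Gamma q\<close> into
    \<open>\<eta> powr q \<le> (R - N) * Gamma (q + 1) / M\<close> gives this bound. For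
    \<open>M = 0\<close> the left side is 0 and \<open>R > N\<close> suffices.\<close>
  have growth: "1 / Gamma q * (M * (\<eta> powr q / q)) \<le> R - N"
  proof (cases "M = 0")
    case False
    then have "0 < M" using \<open>0 \<le> M\<close> by simp
    have "\<eta> powr q \<le> (((R - N) * Gamma (q + 1) / M) powr (1 / q)) powr q"
      using \<eta> assms(2) False by (intro powr_mono2) (simp_all add: assms(13))
    also have "\<dots> = (R - N) * Gamma (q + 1) / M"
      using assms(2,10) Gq \<open>0 < M\<close> by (simp add: powr_powr)
    finally have "M * \<eta> powr q \<le> (R - N) * (q * Gamma q)"
      using \<open>0 < M\<close> by (simp add: pos_le_divide_eq Gq mult.commute)
    then have "M * \<eta> powr q / (q * Gamma q) \<le> R - N"
      using Gq assms(2) by (subst pos_divide_le_eq) simp_all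
    then show ?thesis by (simp add: mult.commute)
  qed (use assms(10) in simp)
  interpret fuzzy_frac_equation q \<eta> M "1 / Gamma q" R K u\<^sub>0 f
  proof
    show "continuous_on {0..\<eta>} u\<^sub>0" "continuous_on ({0<..\<eta>} \<times> RFc) f"
      using \<eta> by (auto intro: continuous_on_subset[OF assms(4)] continuous_on_subset[OF assms(7)])
    show "f (s, x) \<in> K" if "s \<in> {0<..\<eta>}" "x \<in> RFc" "dist x 0 \<le> R" for s x
      using that \<eta> by (intro fG) (simp add: assms(11))
    show "dist (u\<^sub>0 t) 0 + 1 / Gamma q * (M * (\<eta> powr q / q)) \<le> R" if "t \<in> {0..\<eta>}" for t
      using N[of t] growth that \<eta> by simp
  qed (use assms(2,3,5) \<eta> Gq KM \<open>0 \<le> M\<close> \<open>compact K\<close> in \<open>auto simp: K_def\<close>)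
  obtain u where "admissible u"
    "\<And>t. t \<in> {0..\<eta>} \<Longrightarrow> fuzzy_integrable {0<..<t} (\<lambda>s. (t - s) powr (q - 1) *\<^sub>R f (s, u s))"
    "\<And>t. t \<in> {0..\<eta>} \<Longrightarrow> u t = u\<^sub>0 t + (1 / Gamma q) *\<^sub>R fuzzy_integral {0<..<t} (\<lambda>s. (t - s) powr (q - 1) *\<^sub>R f (s, u s))"
    by (rule exists_solution) blast
  then show ?thesis unfolding admissible_def by blast
qed

end
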